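(* Let $A$ be an associative algebra. Then the graded vector space $\bigoplus_{n\ge0}\mathrm{Hom}(A^{\otimes n},A)$ carries an $L_\infty$-algebra structure with structure maps $$l_2(P,Q)=\llbracket P,Q\rrbracket,\qquad l_3(P,Q,R)=\llbracket P,Q,R\rrbracket$$ and all other structure maps trivial, where the brackets are those of the adjoint bimodule $M=A$ with $H=-\mu$, $\mu$ the multiplication of $A$. Moreover, there is a one-to-one correspondence between Maurer-Cartan elements in this $L_\infty$-algebra and Reynolds operators on $A$.
   Context: All vector spaces, linear maps and tensor products are over a field $\mathbb K$ of characteristic $0$. A Reynolds operator on an associative algebra $A$ is a linear map $R:A\to A$ with $R(a)R(b)=R(aR(b)+R(a)b-R(a)R(b))$ for all $a,b\in A$. $L_\infty$-algebras: a graded vector space $L=\bigoplus_i L_i$ with graded skew-symmetric multilinear maps $l_k:L^{\otimes k}\to L$ of degree $2-k$, $k\ge1$ (i.e. $l_k(x_{\sigma(1)},\ldots,x_{\sigma(k)})=(-1)^\sigma\epsilon(\sigma)l_k(x_1,\ldots,x_k)$, $\epsilon(\sigma)$ the Koszul sign) such that for every $n\ge 1$ $$\sum_{i+j=n+1}\sum_\sigma(-1)^\sigma\epsilon(\sigma)(-1)^{i(j-1)}l_j\big(l_i(x_{\sigma(1)},\ldots,x_{\sigma(i)}),x_{\sigma(i+1)},\ldots,x_{\sigma(n)}\big)=0,$$ $\sigma$ running over $(i,n-i)$-unshuffles, $i\ge 1$. If $l_k=0$ for $k>3$, a Maurer-Cartan element is $\alpha\in L_1$ with $l_1(\alpha)+\frac12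 l_2(\alpha,\alpha)-\frac16 l_3(\alpha,\alpha,\alpha)=0$. The brackets: $\mathrm{Hom}(A^{\otimes n},A)$ is placed in degree $n$ (with $\mathrm{Hom}(A^{\otimes 0},A)=A$). Let $M$ be a copy of the vector space $A$, viewed as the adjoint $A$-bimodule (left and right actions given by the multiplication $\mu(a,b)=ab$), let $V=A\oplus M$, and, for the binary bracket, view $P\in\mathrm{Hom}(A^{\otimes p},A)$ as a map $M^{\otimes p}\to A$, extended by zero to a multilinear map $V^{\otimes p}\to V$. For $f\in\mathrm{Hom}(V^{\otimes m},V)$, $g\in\mathrm{Hom}(V^{\otimes n},V)$ the classical Gerstenhaber bracket is $[f,g]_{\mathsf G}=f\circ g-(-1)^{(m-1)(n-1)}g\circ f$, where $f\circ g=\sum_{i=1}^m(-1)^{(i-1)(n-1)}f\circ_i g$ and $f\circ_i g$ inserts $g$ in the $i$-th input of $f$. Let $\Pi((a,u),(b,v))=(ab,av+ub)$ on $V$, and let $H=-\mu$, i.e. $H(a,b)=-ab$ for $a,b\in A$. For $P,Q,R$ of arities $p,q,r$, $$\llbracket P,Q\rrbracket=(-1)^p[[\Pi,P]_{\mathsf G},Q]_{\mathsf G},$$ and the degree $-1$ ternary bracket is $$\begin{aligned} &\llbracket P,Q,R\rrbracket(u_1,\ldots,u_{p+q+r-1})=(-1)^{pqr}\Big\{\\ &\sum_{1\le i\le p}(-1)^{(i-1)q}P\big(u_1,\ldots,u_{i-1},H(Q(u_i,\ldots,u_{i+q-1}),R(u_{i+q},\ldots,u_{i+q+r-1})),\ldots,u_{p+q+r-1}\big)\\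 &-(-1)^{qr}\sum_{1\le i\le p}(-1)^{(i-1)r}P\big(u_1,\ldots,u_{i-1},H(R(u_i,\ldots,u_{i+r-1}),Q(u_{i+r},\ldots,u_{i+q+r-1})),\ldots,u_{p+q+r-1}\big)\\ &-(-1)^{pq}\sum_{1\le i\le q}(-1)^{(i-1)p}Q\big(u_1,\ldots,u_{i-1},H(P(u_i,\ldots,u_{i+p-1}),R(u_{i+p},\ldots,u_{i+p+r-1})),\ldots,u_{p+q+r-1}\big)\\ &+(-1)^{p(q+r)}\sum_{1\le i\le q}(-1)^{(i-1)r}Q\big(u_1,\ldots,u_{i-1},H(R(u_i,\ldots,u_{i+r-1}),P(u_{i+r},\ldots,u_{i+p+r-1})),\ldots,u_{p+q+r-1}\big)\\ &-(-1)^{pq+qr+rp}\sum_{1\le i\le r}(-1)^{(i-1)q}R\big(u_1,\ldots,u_{i-1},H(Q(u_i,\ldots,u_{i+q-1}),P(u_{i+q},\ldots,u_{i+p+q-1})),\ldots,u_{p+q+r-1}\big)\\ &+(-1)^{(p+q)r}\sum_{1\le i\le r}(-1)^{(i-1)p}R\big(u_1,\ldots,u_{i-1},H(P(u_i,\ldots,u_{i+p-1}),Q(u_{i+p},\ldots,u_{i+p+q-1})),\ldots,u_{p+q+r-1}\big)\Big\}. \end{aligned}$$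
   Formalization: The signs of the ternary bracket are corrected: its first sum carries (-1)^{p-1+qr+(i-1)(q+r-1)} instead of (-1)^{pqr+(i-1)q}, the other five accordingly; with the printed signs the n=4 identity fails for A=K and the elements 1, id, id, id. *)

theory Defs
  imports
    Complex_Main
    "HOL-Combinatorics.Permutations"
    "HOL-Library.Function_Algebras"
    "HOL-Library.Product_Plus"
begin

section \<open>Signs and multilinear maps\<close>

text \<open>\<open>alt e x\<close> is $(-1)^e x$. The exponent is an integer because factors such as $n - 1$
  occur with $n = 0$.\<close>

definition alt :: "int \<Rightarrow> 'a::ab_group_add \<Rightarrow> 'a" where
  "alt e x = (if even e then x else - x)"

definition multilinear_on ::
  "('k \<Rightarrow> 'x::ab_group_add \<Rightarrow> 'x) \<Rightarrow> 'x set \<Rightarrow> ('k \<Rightarrow> 'y::ab_group_add \<Rightarrow> 'y)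
    \<Rightarrow> nat \<Rightarrow> ('x list \<Rightarrow> 'y) \<Rightarrow> bool" where
  "multilinear_on s X t n f \<longleftrightarrow>
    (\<forall>xs i y z c. length xs = n \<and> set xs \<subseteq> X \<and> i < n \<and> y \<in> X \<and> z \<in> X \<longrightarrow>
      f (xs[i := y + z]) = f (xs[i := y]) + f (xs[i := z]) \<and>
      f (xs[i := s c y]) = t c (f (xs[i := y])))"

section \<open>L-infinity algebras\<close>

text \<open>A graded vector space is an internal direct sum: \<open>L i\<close> is the component of degree \<open>i\<close>
  and \<open>total\<close> is $\bigoplus_i L_i$.\<close>

locale graded_vector_space = vector_space scale
  for scale :: "'k::field_char_0 \<Rightarrow> 'v::ab_group_add \<Rightarrow> 'v" +
  fixes L :: "int \<Rightarrow> 'v set"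
  assumes subspace_component: "subspace (L i)"
    and independent_components:
      "\<lbrakk>finite I; \<And>i. i \<in> I \<Longrightarrow> x i \<in> L i; (\<Sum>i\<in>I. x i) = 0; i \<in> I\<rbrakk> \<Longrightarrow> x i = 0"
begin

definition total :: "'v set" where
  "total = span (\<Union>i. L i)"

definition homogeneous :: "int list \<Rightarrow> 'v list \<Rightarrow> bool" where
  "homogeneous ds xs \<longleftrightarrow> list_all2 (\<lambda>d x. x \<in> L d) ds xs"

end

text \<open>The Koszul sign $\epsilon(\sigma)$ of $x_1,\dots,x_n \mapsto x_{\sigma(1)},\dots,x_{\sigma(n)}$
  for elements of degrees \<open>ds\<close>, as a product over the inversions of \<open>\<sigma>\<close>. Positions are
  counted from 0.\<close>

definition koszul_sign :: "int list \<Rightarrow> (nat \<Rightarrow> nat) \<Rightarrow> int" where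
  "koszul_sign ds \<sigma> =
    (\<Prod>(a, b) \<in> {(a, b). a < b \<and> b < length ds \<and> \<sigma> b < \<sigma> a}. alt (ds ! \<sigma> a * ds ! \<sigma> b) 1)"

definition unshuffles :: "nat \<Rightarrow> nat \<Rightarrow> (nat \<Rightarrow> nat) set" where
  "unshuffles i n =
    {\<sigma>. \<sigma> permutes {..<n} \<and> strict_mono_on {..<i} \<sigma> \<and> strict_mono_on {i..<n} \<sigma>}"

text \<open>\<open>l k\<close> only matters on lists of length \<open>k\<close> with entries in \<open>total\<close>.\<close>

locale L_infinity_algebra = graded_vector_space scale L
  for scale :: "'k::field_char_0 \<Rightarrow> 'v::ab_group_add \<Rightarrow> 'v" and L :: "int \<Rightarrow> 'v set" +
  fixes l :: "nat \<Rightarrow> 'v list \<Rightarrow> 'v"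
  assumes multilinear:
      "k \<ge> 1 \<Longrightarrow> multilinear_on scale total scale k (l k)"
    and degree:
      "\<lbrakk>k \<ge> 1; length xs = k; homogeneous ds xs\<rbrakk> \<Longrightarrow> l k xs \<in> L (sum_list ds + 2 - int k)"
    and graded_skew:
      "\<lbrakk>k \<ge> 1; length xs = k; homogeneous ds xs; \<sigma> permutes {..<k}\<rbrakk> \<Longrightarrow>
        l k (permute_list \<sigma> xs) = scale (of_int (sign \<sigma> * koszul_sign ds \<sigma>)) (l k xs)"
    and higher_jacobi:
      "\<lbrakk>n \<ge> 1; length xs = n; homogeneous ds xs\<rbrakk> \<Longrightarrow>
        (\<Sum>(i, j) \<in> {(i, j). 1 \<le> i \<and> 1 \<le> j \<and> i + j = n + 1}. \<Sum>\<sigma> \<in> unshuffles i n.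
          scale (of_int (sign \<sigma> * koszul_sign ds \<sigma> * (- 1) ^ (i * (j - 1))))
            (l j (l i (take i (permute_list \<sigma> xs)) # drop i (permute_list \<sigma> xs)))) = 0"

text \<open>The Maurer-Cartan equation, for structures with \<open>l k\<close> zero for \<open>k > 3\<close>.\<close>

definition maurer_cartan ::
  "('k::field_char_0 \<Rightarrow> 'v::ab_group_add \<Rightarrow> 'v) \<Rightarrow> (int \<Rightarrow> 'v set)
    \<Rightarrow> (nat \<Rightarrow> 'v list \<Rightarrow> 'v) \<Rightarrow> 'v \<Rightarrow> bool" where
  "maurer_cartan scale L l \<alpha> \<longleftrightarrow>
    \<alpha> \<in> L 1 \<and>
    l 1 [\<alpha>] + scale (1 / 2) (l 2 [\<alpha>, \<alpha>]) - scale (1 / 6) (l 3 [\<alpha>, \<alpha>, \<alpha>]) = 0"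

section \<open>Associative algebras and Reynolds operators\<close>

locale assoc_algebra = vector_space scale
  for scale :: "'k::field_char_0 \<Rightarrow> 'a::ring \<Rightarrow> 'a" +
  assumes scale_mult_left: "scale c a * b = scale c (a * b)"
    and scale_mult_right: "a * scale c b = scale c (a * b)"

definition reynolds_operator ::
  "('k::field_char_0 \<Rightarrow> 'a::ring \<Rightarrow> 'a) \<Rightarrow> ('a \<Rightarrow> 'a) \<Rightarrow> bool" where
  "reynolds_operator scale R \<longleftrightarrow>
    Vector_Spaces.linear scale scale R \<and>
    (\<forall>a b. R a * R b = R (a * R b + R a * b - R a * R b))"

section \<open>The graded space of cochains\<close>

text \<open>An element of $\mathrm{Hom}(A^{\otimes n}, A)$ is a multilinear function on lists of
  length \<open>n\<close>, extended by 0 to lists of other lengths. All these spaces, and their direct sum,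
  then live in \<open>'a list \<Rightarrow> 'a\<close>.\<close>

definition cochains :: "('k \<Rightarrow> 'a::ring \<Rightarrow> 'a) \<Rightarrow> nat \<Rightarrow> ('a list \<Rightarrow> 'a) set" where
  "cochains scale n =
    {P. multilinear_on scale UNIV scale n P \<and> (\<forall>xs. length xs \<noteq> n \<longrightarrow> P xs = 0)}"

definition cochain_scale :: "('k \<Rightarrow> 'a \<Rightarrow> 'a) \<Rightarrow> 'k \<Rightarrow> ('a list \<Rightarrow> 'a) \<Rightarrow> 'a list \<Rightarrow> 'a" where
  "cochain_scale scale c P = (\<lambda>xs. scale c (P xs))"

definition cochain_grading :: "('k \<Rightarrow> 'a::ring \<Rightarrow> 'a) \<Rightarrow> int \<Rightarrow> ('a list \<Rightarrow> 'a) set" where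
  "cochain_grading scale d = (if d < 0 then {0} else cochains scale (nat d))"

definition cochain_component :: "nat \<Rightarrow> ('a list \<Rightarrow> 'a::ring) \<Rightarrow> 'a list \<Rightarrow> 'a" where
  "cochain_component n P = (\<lambda>xs. if length xs = n then P xs else 0)"

definition cochain_of_map :: "('a \<Rightarrow> 'a) \<Rightarrow> 'a list \<Rightarrow> 'a::ring" where
  "cochain_of_map R = (\<lambda>xs. if length xs = 1 then R (xs ! 0) else 0)"

section \<open>The binary bracket\<close>

text \<open>In \<open>gerstenhaber_comp m f n g\<close> and \<open>gerstenhaber m f n g\<close> the maps \<open>f\<close> and \<open>g\<close> have
  arities \<open>m\<close> and \<open>n\<close>; the result is meant for lists of length \<open>m + n - 1\<close>.\<close>

definition insert_at :: "nat \<Rightarrow> ('v list \<Rightarrow> 'v) \<Rightarrow> nat \<Rightarrow> ('v list \<Rightarrow> 'v) \<Rightarrow> 'v list \<Rightarrow> 'v" where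
  "insert_at i f n g vs =
    f (take (i - 1) vs @ g (take n (drop (i - 1) vs)) # drop (i - 1 + n) vs)"

definition gerstenhaber_comp ::
  "nat \<Rightarrow> ('v list \<Rightarrow> 'v) \<Rightarrow> nat \<Rightarrow> ('v list \<Rightarrow> 'v) \<Rightarrow> 'v list \<Rightarrow> 'v::ab_group_add" where
  "gerstenhaber_comp m f n g vs =
    (\<Sum>i = 1..m. alt ((int i - 1) * (int n - 1)) (insert_at i f n g vs))"

definition gerstenhaber ::
  "nat \<Rightarrow> ('v list \<Rightarrow> 'v) \<Rightarrow> nat \<Rightarrow> ('v list \<Rightarrow> 'v) \<Rightarrow> 'v list \<Rightarrow> 'v::ab_group_add" where
  "gerstenhaber m f n g vs =
    gerstenhaber_comp m f n g vs
      - alt ((int m - 1) * (int n - 1)) (gerstenhaber_comp n g m f vs)"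

text \<open>$V = A \oplus M$ with $M = A$ the adjoint bimodule is \<open>'a \<times> 'a\<close>, the second factor
  being $M$. \<open>extend P\<close> is \<open>P\<close>, regarded as a map $M^{\otimes p} \to A$, extended by zero to
  $V$.\<close>

definition semidirect :: "('a \<times> 'a) list \<Rightarrow> 'a \<times> 'a::ring" where
  "semidirect vs = (case (vs ! 0, vs ! 1) of ((a, u), (b, v)) \<Rightarrow> (a * b, a * v + u * b))"

definition extend :: "('a list \<Rightarrow> 'a) \<Rightarrow> ('a \<times> 'a) list \<Rightarrow> 'a \<times> 'a::ring" where
  "extend P vs = (P (map snd vs), 0)"

text \<open>$[\Pi, P]$ has arity $p + 1$. The final result is read as a map $M^{\otimes (p+q)} \to A$
  by evaluating on $M$ and projecting to $A$.\<close>

definition binary_bracket ::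
  "nat \<Rightarrow> nat \<Rightarrow> ('a list \<Rightarrow> 'a) \<Rightarrow> ('a list \<Rightarrow> 'a) \<Rightarrow> 'a list \<Rightarrow> 'a::ring" where
  "binary_bracket p q P Q us =
    (if length us = p + q
     then alt (int p)
       (fst (gerstenhaber (p + 1) (gerstenhaber 2 semidirect p (extend P)) q (extend Q)
         (map (\<lambda>u. (0, u)) us)))
     else 0)"

section \<open>The ternary bracket\<close>

definition neg_mult :: "'a \<Rightarrow> 'a \<Rightarrow> 'a::ring" where
  "neg_mult a b = - (a * b)"

text \<open>\<open>nested p q r P Q R\<close> is the sum over \<open>i\<close> of
  $P(u_1,\dots,u_{i-1},H(Q(u_i,\dots),R(u_{i+q},\dots)),\dots,u_{p+q+r-1})$ with its signs.

  The signs are those of the derived bracket $-(-1)^q [[[H,P],Q],R]$. The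
  literature also has the six-term formula below with the sign $(-1)^{pqr + (i-1)q}$ in place of
  the sign $(-1)^{(p-1) + qr + (i-1)(q+r-1)}$ used here (and correspondingly in the other five
  sums). The two agree for $p = q = r = 1$, hence give the same Maurer-Cartan equation, but with
  $(-1)^{pqr + (i-1)q}$ the higher Jacobi identity for $n = 4$ fails: take $A$ to be the ground
  field and the four elements $1 \in A$ (arity 0) and three times the identity map (arity 1).
  Then the only nonzero summands are the three of the form $l_3(l_2(id, id), 1, id)$ (up to
  reordering of arguments); they coincide and add up to a nonzero multiple of $u_1 u_2$.\<close>

definition nested ::
  "nat \<Rightarrow> nat \<Rightarrow> nat \<Rightarrow> ('a list \<Rightarrow> 'a) \<Rightarrow> ('a list \<Rightarrow> 'a) \<Rightarrow> ('a list \<Rightarrow> 'a)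
    \<Rightarrow> 'a list \<Rightarrow> 'a::ring" where
  "nested p q r P Q R us =
    (\<Sum>i = 1..p. alt ((int p - 1) + int q * int r + (int i - 1) * (int q + int r - 1))
      (P (take (i - 1) us
          @ neg_mult (Q (take q (drop (i - 1) us))) (R (take r (drop (i - 1 + q) us)))
          # drop (i - 1 + q + r) us)))"

definition ternary_bracket ::
  "nat \<Rightarrow> nat \<Rightarrow> nat \<Rightarrow> ('a list \<Rightarrow> 'a) \<Rightarrow> ('a list \<Rightarrow> 'a) \<Rightarrow> ('a list \<Rightarrow> 'a)
    \<Rightarrow> 'a list \<Rightarrow> 'a::ring" where
  "ternary_bracket p q r P Q R us =
    (if length us + 1 = p + q + r
     then nested p q r P Q R us
       - alt (int (q * r)) (nested p r q P R Q us)
       - alt (int (p * q)) (nested q p r Q P R us)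
       + alt (int (p * (q + r))) (nested q r p Q R P us)
       - alt (int (p * q + q * r + r * p)) (nested r q p R Q P us)
       + alt (int ((p + q) * r)) (nested r p q R P Q us)
     else 0)"

section \<open>The structure maps\<close>

text \<open>The brackets are extended multilinearly from homogeneous elements. Only finitely many
  arities contribute to the value at a given list, since $l_2$ has degree 0 and $l_3$ has
  degree $-1$.\<close>

definition cochain_structure :: "nat \<Rightarrow> ('a list \<Rightarrow> 'a) list \<Rightarrow> 'a list \<Rightarrow> 'a::ring" where
  "cochain_structure k Ps us =
    (if k = 2 then
       \<Sum>(p, q) \<in> {(p, q). p + q = length us}.
         binary_bracket p q (cochain_component p (Ps ! 0)) (cochain_component q (Ps ! 1)) us
     else if k = 3 then
       \<Sum>(p, q, r) \<in> {(p, q, r). p + q + r = length us + 1}.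
         ternary_bracket p q r (cochain_component p (Ps ! 0)) (cochain_component q (Ps ! 1))
           (cochain_component r (Ps ! 2)) us
     else 0)"

end

theory Submission
  imports Defs
begin

text \<open>The multilinear maps on lists over $V = A \oplus M$ form a graded Lie algebra under the Gerstenhaber
  bracket. Give a map weight $w$ if it raises the number of letters from $A$ by $w$. Since
  $V$ has only the weights 0 and 1, no map has weight 2, and the maps of weight 1 are exactly the
  cochains $M^{\otimes n} \to A$; they form an abelian subalgebra. The products $\Theta$ on $V$ and
  $H : A \otimes A \to M$ have weights $-1$ and $-2$, so that $[[\Theta, P], Q]$ and $[[[H, P], Q], R]$
  are again cochains. Associativity gives
  $[\Theta, \Theta] = [\Theta, H] = [H, H] = 0$. Applying the commuting derivations $[\cdot, P_i]$ to these
  three equations, the Leibniz rule leaves only the terms in which at most two of the $P_i$ go to each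
  $\Theta$ and at most three to each $H$; these are the higher Jacobi identities for 3, 4 and 5
  arguments, and there are no others. The Maurer-Cartan equation is evaluated on two arguments.\<close>

text \<open>The three equations are the parts of different weight of a single one:
  \<open>\<Theta> + H\<close> is the semidirect product deformed by the Hochschild 2-cocycle
  \<open>- \<mu>\<close>, hence again associative, and the weights -2, -3 and -4 of its square
  vanish separately. The real obstacle is the bookkeeping of signs and arities. Compositions are
  therefore sums over factorizations of the argument list, with signs read off from the lengths of
  the pieces. A term whose pieces have the wrong length vanishes, since a multilinear map is zero on
  a list that contains 0; so these signs may be compared with signs given by degrees on the
  remaining terms only, and the bracket needs no arity as a parameter. Lie signs use the degree
  \<open>p - 1\<close>, L-infinity signs the arity \<open>p\<close>; the shift accounts for the
  prefactors of the derived brackets. Each Jacobi identity involves a fixed, small number of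
  arguments, so its unshuffles can be listed and its signs settled by cases on parities. An equation
  with the same product twice yields each Jacobi summand twice, which is why 2-torsion must be
  excluded.\<close>

lemma alt_0 [simp]: "alt e 0 = 0"
  and alt_add: "alt e (x + y) = alt e x + alt e y"
  and alt_minus: "alt e (- x) = - alt e x"
  and alt_diff: "alt e (x - y) = alt e x - alt e y"
  and alt_alt [simp]: "alt e (alt f x) = alt (e + f) x"
  by (auto simp: alt_def)

lemma alt_eq_0_iff: "alt e x = 0 \<longleftrightarrow> x = 0"
  by (auto simp: alt_def)

lemma alt_sum: "alt e (sum f A) = (\<Sum>x\<in>A. alt e (f x))"
  by (simp add: alt_def sum_negf)

lemma alt_sum_list: "alt e (sum_list (map f zs)) = (\<Sum>z\<leftarrow>zs. alt e (f z))"
  by (induction zs) (simp_all add: alt_add)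

lemma alt_cong: "even (e - f) \<Longrightarrow> alt e x = alt f x"
  by (auto simp: alt_def)

lemma alt_apply: "alt e f x = alt e (f x)"
  by (simp add: alt_def)

lemma sum_apply: "sum f A x = (\<Sum>a\<in>A. f a x)"
  by (induction A rule: infinite_finite_induct) auto

section \<open>Decompositions of lists\<close>

definition cuts :: "'v list \<Rightarrow> ('v list \<times> 'v list) set" where
  "cuts vs = {(xs, ys). xs @ ys = vs}"

text \<open>The middle piece is the sublist that an inserted map consumes. Sums over triples replace
  sums over positions with prescribed arities.\<close>

definition splits :: "'v list \<Rightarrow> ('v list \<times> 'v list \<times> 'v list) set" where
  "splits vs = {(xs, ys, zs). xs @ ys @ zs = vs}"

lemma finite_cuts [simp]: "finite (cuts vs)"
  and finite_splits [simp]: "finite (splits vs)"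
proof -
  let ?S = "{xs. set xs \<subseteq> set vs \<and> length xs \<le> length vs}"
  have "finite ?S" by (rule finite_lists_length_le) simp
  moreover have "cuts vs \<subseteq> ?S \<times> ?S" "splits vs \<subseteq> ?S \<times> ?S \<times> ?S"
    by (auto simp: cuts_def splits_def)
  ultimately show "finite (cuts vs)" "finite (splits vs)"
    by (meson finite_SigmaI finite_subset)+
qed

text \<open>The chosen sublist of a list with a marked letter lies after, around or before that letter.\<close>

lemma sum_splits_marked:
  "(\<Sum>(xs', ys', zs')\<in>splits (xs @ w # zs). \<phi> xs' ys' zs') =
    (\<Sum>(t, y, z)\<in>splits zs. \<phi> (xs @ w # t) y z) +
    (\<Sum>(x1, x2)\<in>cuts xs. \<Sum>(z1, z2)\<in>cuts zs. \<phi> x1 (x2 @ w # z1) z2) +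
    (\<Sum>(x1, y1, x2)\<in>splits xs. \<phi> x1 y1 (x2 @ w # zs))"
proof -
  define A where "A = (\<lambda>(t, y, z). (xs @ w # t, y, z)) ` splits zs"
  define B where "B = (\<lambda>((x1, x2), (z1, z2)). (x1, x2 @ w # z1, z2)) ` (cuts xs \<times> cuts zs)"
  define C where "C = (\<lambda>(x1, y1, x2). (x1, y1, x2 @ w # zs)) ` splits xs"
  have "splits (xs @ w # zs) \<subseteq> A \<union> B \<union> C"
  proof
    fix s assume s: "s \<in> splits (xs @ w # zs)"
    obtain x y z where [simp]: "s = (x, y, z)" by (cases s)
    have eq: "x @ y @ z = xs @ w # zs" using s by (simp add: splits_def)
    consider t where "x = xs @ w # t" "t @ y @ z = zs"
      | x2 where "xs = x @ x2" "y @ z = x2 @ w # zs"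
      using eq unfolding append_eq_append_conv2[of x] by (auto simp: append_eq_Cons_conv)
    then show "s \<in> A \<union> B \<union> C"
    proof cases
      case 1
      then show ?thesis by (force simp: A_def splits_def)
    next
      case 2
      then consider z1 where "y = x2 @ w # z1" "z1 @ z = zs"
        | x3 where "x2 = y @ x3" "z = x3 @ w # zs"
        unfolding append_eq_append_conv2[of y] append_eq_Cons_conv by auto
      then show ?thesis using 2
        by cases (force simp: B_def C_def splits_def cuts_def image_iff)+
    qed
  qed
  moreover have "A \<union> B \<union> C \<subseteq> splits (xs @ w # zs)"
    by (auto simp: A_def B_def C_def splits_def cuts_def)
  ultimately have un: "splits (xs @ w # zs) = A \<union> B \<union> C" by blast
  have fin: "finite A" "finite B" "finite C"
    by (simp_all add: A_def B_def C_def)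
  \<comment> \<open>The three families are disjoint because they differ in whether the chosen piece
    begins after the marked letter and whether it ends before it; both can be read off from
    lengths.\<close>
  have lA: "length x > length xs" if "(x, y, z) \<in> A" for x y z
    using that by (auto simp: A_def)
  have lB: "length x \<le> length xs \<and> length x + length y > length xs" if "(x, y, z) \<in> B" for x y z
    using that by (auto simp: B_def cuts_def)
  have lC: "length x + length y \<le> length xs" if "(x, y, z) \<in> C" for x y z
    using that by (auto simp: C_def splits_def)
  have AB: "A \<inter> B = {}" using lA lB by fastforce
  have ABC: "(A \<union> B) \<inter> C = {}" using lA lB lC by fastforce
  have sA: "(\<Sum>(x, y, z)\<in>A. \<phi> x y z) = (\<Sum>(t, y, z)\<in>splits zs. \<phi> (xs @ w # t) y z)"
    unfolding A_def by (subst sum.reindex) (auto simp: inj_on_def case_prod_unfold)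
  have sB: "(\<Sum>(x, y, z)\<in>B. \<phi> x y z) =
      (\<Sum>(x1, x2)\<in>cuts xs. \<Sum>(z1, z2)\<in>cuts zs. \<phi> x1 (x2 @ w # z1) z2)"
    unfolding B_def
    by (subst sum.reindex)
       (auto simp: inj_on_def case_prod_unfold sum.cartesian_product cuts_def)
  have sC: "(\<Sum>(x, y, z)\<in>C. \<phi> x y z) = (\<Sum>(x1, y1, x2)\<in>splits xs. \<phi> x1 y1 (x2 @ w # zs))"
    unfolding C_def by (subst sum.reindex) (auto simp: inj_on_def case_prod_unfold)
  show ?thesis
    unfolding un sA[symmetric] sB[symmetric] sC[symmetric]
    by (simp add: sum.union_disjoint fin AB ABC)
qed

section \<open>The Gerstenhaber bracket\<close>

definition multi :: "('k \<Rightarrow> 'v \<Rightarrow> 'v) \<Rightarrow> ('v list \<Rightarrow> 'v::ab_group_add) \<Rightarrow> bool" where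
  "multi s f \<longleftrightarrow> (\<forall>xs y z zs c. f (xs @ (y + z) # zs) = f (xs @ y # zs) + f (xs @ z # zs) \<and>
      f (xs @ s c y # zs) = s c (f (xs @ y # zs)))"

text \<open>The degree is the arity minus one. Degree -1 consists of the constants; below it only
  the zero map is left.\<close>

definition maps :: "('k \<Rightarrow> 'v \<Rightarrow> 'v) \<Rightarrow> int \<Rightarrow> ('v list \<Rightarrow> 'v::ab_group_add) set" where
  "maps s d = {f. multi s f \<and> (\<forall>vs. int (length vs) \<noteq> d + 1 \<longrightarrow> f vs = 0)}"

text \<open>The Gerstenhaber circle product. The position is \<open>length xs + 1\<close> and the
  arity of \<open>g\<close> is \<open>length ys\<close>, which turns the usual exponent into the one
  here; for multilinear \<open>f\<close>, pieces \<open>ys\<close> of any other length contribute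
  0.\<close>

definition cmp :: "('v list \<Rightarrow> 'v) \<Rightarrow> ('v list \<Rightarrow> 'v) \<Rightarrow> 'v list \<Rightarrow> 'v::ab_group_add" where
  "cmp f g vs = (\<Sum>(xs, ys, zs)\<in>splits vs.
    alt (int (length xs) * (int (length ys) - 1)) (f (xs @ g ys # zs)))"

lemma maps_len: "f \<in> maps s d \<Longrightarrow> int (length vs) \<noteq> d + 1 \<Longrightarrow> f vs = 0"
  by (simp add: maps_def)

lemma multi_add: "multi s f \<Longrightarrow> f (xs @ (y + z) # zs) = f (xs @ y # zs) + f (xs @ z # zs)"
  and multi_scale: "multi s f \<Longrightarrow> f (xs @ s c y # zs) = s c (f (xs @ y # zs))"
  by (simp_all add: multi_def)

lemma multi_0:
  assumes "multi s f" shows "f (xs @ 0 # zs) = 0"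
  using multi_add[OF assms, of xs 0 0 zs] by simp

lemma multi_alt:
  assumes "multi s f" shows "f (xs @ alt e y # zs) = alt e (f (xs @ y # zs))"
proof -
  have "f (xs @ y # zs) + f (xs @ (- y) # zs) = 0"
    using multi_add[OF assms, of xs y "- y" zs] multi_0[OF assms] by simp
  then have "f (xs @ (- y) # zs) = - f (xs @ y # zs)"
    by (simp add: add_eq_0_iff)
  then show ?thesis by (simp add: alt_def)
qed

lemma multi_sum:
  assumes "multi s f" shows "f (xs @ sum h A # zs) = (\<Sum>a\<in>A. f (xs @ h a # zs))"
  by (induction A rule: infinite_finite_induct)
     (simp_all add: multi_0[OF assms] multi_add[OF assms])

lemma maps_multi: "f \<in> maps s d \<Longrightarrow> multi s f"
  by (simp add: maps_def)

text \<open>The marked letter \<open>w\<close> serves either as the value of a map inserted earlier,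
  for iterated compositions, or as a variable slot, for multilinearity of the composite.\<close>

lemma cmp_marked:
  "cmp f g (xs @ w # zs) =
    (\<Sum>(t, y, z)\<in>splits zs. alt (int (length xs + 1 + length t) * (int (length y) - 1))
      (f (xs @ w # t @ g y # z))) +
    (\<Sum>(x1, x2)\<in>cuts xs. \<Sum>(z1, z2)\<in>cuts zs.
      alt (int (length x1) * int (length x2 + length z1)) (f (x1 @ g (x2 @ w # z1) # z2))) +
    (\<Sum>(x1, y1, x2)\<in>splits xs. alt (int (length x1) * (int (length y1) - 1))
      (f (x1 @ g y1 # x2 @ w # zs)))"
  unfolding cmp_def sum_splits_marked by (simp add: algebra_simps)

text \<open>The failure of associativity is symmetric in the last two arguments: it consists of the
  terms in which \<open>g\<close> and \<open>h\<close> are inserted side by side.\<close>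

definition beside ::
    "('v list \<Rightarrow> 'v) \<Rightarrow> ('v list \<Rightarrow> 'v) \<Rightarrow> ('v list \<Rightarrow> 'v) \<Rightarrow> 'v list \<Rightarrow> 'v::ab_group_add" where
  "beside f g h vs = (\<Sum>(xs, ys, ws)\<in>splits vs. \<Sum>(ts, us, zs)\<in>splits ws.
    alt (int (length xs) * (int (length ys) - 1) +
        int (length xs + length ys + length ts) * (int (length us) - 1))
      (f (xs @ g ys # ts @ h us # zs)))"

text \<open>Both sides run over the factorizations of \<open>vs\<close> into five consecutive pieces
  \<open>xs\<close>, \<open>ys\<close>, \<open>ts\<close>, \<open>us\<close>,
  \<open>zs\<close>.\<close>

lemma splits_assoc:
  "(\<Sum>(xs, ys, ws)\<in>splits vs. \<Sum>(ts, us, zs)\<in>splits ws. \<phi> xs ys ts us zs) =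
   (\<Sum>(ws, us, zs)\<in>splits vs. \<Sum>(xs, ys, ts)\<in>splits ws. \<phi> xs ys ts us zs)"
  by (simp add: sum.Sigma case_prod_unfold,
      rule sum.reindex_bij_witness[of _
        "\<lambda>((w, u, z), (x, y, t)). ((x, y, t @ u @ z), (t, u, z))"
        "\<lambda>((x, y, w), (t, u, z)). ((x @ y @ t, u, z), (x, y, t))"])
     (auto simp: splits_def)

text \<open>Again five consecutive pieces, now \<open>x1\<close>, \<open>x2\<close>,
  \<open>ys\<close>, \<open>z1\<close>, \<open>z2\<close>; on the right the middle three are first
  grouped as the argument of an outer insertion.\<close>

lemma splits_nested:
  "(\<Sum>(xs, ys, zs)\<in>splits vs. \<Sum>(x1, x2)\<in>cuts xs. \<Sum>(z1, z2)\<in>cuts zs. \<phi> x1 x2 ys z1 z2) =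
   (\<Sum>(x1, ws, z2)\<in>splits vs. \<Sum>(x2, ys, z1)\<in>splits ws. \<phi> x1 x2 ys z1 z2)"
  by (simp add: sum.cartesian_product sum.Sigma case_prod_unfold,
      rule sum.reindex_bij_witness[of _
        "\<lambda>((x1, w, z2), (x2, y, z1)). ((x1 @ x2, y, z1 @ z2), (x1, x2), (z1, z2))"
        "\<lambda>((x, y, z), (x1, x2), (z1, z2)). ((x1, x2 @ y @ z1, z2), (x2, y, z1))"])
     (auto simp: splits_def cuts_def)

text \<open>With the value of \<open>h\<close> as marked letter, \<open>g\<close> is applied to the
  right of it, around it or to its left. These cases give the last, the first and the second term
  respectively.\<close>

lemma cmp_cmp:
  assumes f: "multi s f" and g: "g \<in> maps s d" and h: "h \<in> maps s e"
  shows "cmp (cmp f g) h vs =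
    cmp f (cmp g h) vs + beside f g h vs + alt (d * e) (beside f h g vs)"
proof -
  let ?l = "\<lambda>xs. int (length xs)"
  have "cmp (cmp f g) h vs =
      (\<Sum>(xs, ys, zs)\<in>splits vs. \<Sum>(t, y, z)\<in>splits zs.
        alt (?l xs * (?l ys - 1) + (?l xs + 1 + ?l t) * (?l y - 1)) (f (xs @ h ys # t @ g y # z))) +
      (\<Sum>(xs, ys, zs)\<in>splits vs. \<Sum>(x1, x2)\<in>cuts xs. \<Sum>(z1, z2)\<in>cuts zs.
        alt (?l xs * (?l ys - 1) + ?l x1 * (?l x2 + ?l z1)) (f (x1 @ g (x2 @ h ys # z1) # z2))) +
      (\<Sum>(xs, ys, zs)\<in>splits vs. \<Sum>(x1, y1, x2)\<in>splits xs.
        alt (?l xs * (?l ys - 1) + ?l x1 * (?l y1 - 1)) (f (x1 @ g y1 # x2 @ h ys # zs)))"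
    unfolding cmp_def[of "cmp f g"] cmp_marked
    by (simp add: alt_add alt_sum case_prod_unfold sum.distrib add_ac)
  also have "(\<Sum>(xs, ys, zs)\<in>splits vs. \<Sum>(t, y, z)\<in>splits zs.
      alt (?l xs * (?l ys - 1) + (?l xs + 1 + ?l t) * (?l y - 1)) (f (xs @ h ys # t @ g y # z))) =
      alt (d * e) (beside f h g vs)"
  proof -
    \<comment> \<open>Replacing the single letter \<open>h ys\<close> by the piece \<open>ys\<close>
      changes the exponent by \<open>(?l ys - 1) * (?l y - 1)\<close>, which is \<open>e * d\<close>
      whenever the term is nonzero.\<close>
    have "alt (?l xs * (?l ys - 1) + (?l xs + 1 + ?l t) * (?l y - 1)) (f (xs @ h ys # t @ g y # z))
       = alt (d * e + (?l xs * (?l ys - 1) + (?l xs + ?l ys + ?l t) * (?l y - 1)))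
           (f (xs @ h ys # t @ g y # z))" for xs ys t y z
    proof (cases "?l ys = e + 1 \<and> ?l y = d + 1")
      case True
      then show ?thesis by (intro alt_cong) (auto simp: algebra_simps)
    next
      case False
      then have "h ys = 0 \<or> g y = 0" using maps_len[OF h] maps_len[OF g] by blast
      moreover have "f (xs @ h ys # t @ 0 # z) = 0"
        using multi_0[OF f, of "xs @ h ys # t" z] by simp
      moreover have "f (xs @ 0 # t @ g y # z) = 0"
        using multi_0[OF f, of xs] by simp
      ultimately show ?thesis by auto
    qed
    then show ?thesis
      by (simp add: beside_def alt_sum case_prod_unfold)
  qed
  also have "(\<Sum>(xs, ys, zs)\<in>splits vs. \<Sum>(x1, x2)\<in>cuts xs. \<Sum>(z1, z2)\<in>cuts zs.
      alt (?l xs * (?l ys - 1) + ?l x1 * (?l x2 + ?l z1)) (f (x1 @ g (x2 @ h ys # z1) # z2))) =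
      cmp f (cmp g h) vs"
  proof -
    have "(\<Sum>(xs, ys, zs)\<in>splits vs. \<Sum>(x1, x2)\<in>cuts xs. \<Sum>(z1, z2)\<in>cuts zs.
        alt (?l xs * (?l ys - 1) + ?l x1 * (?l x2 + ?l z1)) (f (x1 @ g (x2 @ h ys # z1) # z2))) =
      (\<Sum>(xs, ys, zs)\<in>splits vs. \<Sum>(x1, x2)\<in>cuts xs. \<Sum>(z1, z2)\<in>cuts zs.
        alt ((?l x1 + ?l x2) * (?l ys - 1) + ?l x1 * (?l x2 + ?l z1))
          (f (x1 @ g (x2 @ h ys # z1) # z2)))"
      by (rule sum.cong[OF refl]) (auto intro!: sum.cong simp: cuts_def)
    also have "\<dots> = (\<Sum>(x1, ws, z2)\<in>splits vs. \<Sum>(x2, ys, z1)\<in>splits ws.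
        alt ((?l x1 + ?l x2) * (?l ys - 1) + ?l x1 * (?l x2 + ?l z1))
          (f (x1 @ g (x2 @ h ys # z1) # z2)))"
      by (rule splits_nested)
    also have "\<dots> = (\<Sum>(x1, ws, z2)\<in>splits vs. \<Sum>(x2, ys, z1)\<in>splits ws.
        alt (?l x1 * (?l ws - 1) + ?l x2 * (?l ys - 1))
          (f (x1 @ g (x2 @ h ys # z1) # z2)))"
      by (rule sum.cong[OF refl], clarsimp, rule sum.cong[OF refl])
         (auto intro!: alt_cong simp: splits_def algebra_simps)
    also have "\<dots> = cmp f (cmp g h) vs"
      unfolding cmp_def
      by (simp add: multi_sum[OF f] multi_alt[OF f] alt_sum case_prod_unfold)
    finally show ?thesis .
  qed
  also have "(\<Sum>(xs, ys, zs)\<in>splits vs. \<Sum>(x1, y1, x2)\<in>splits xs.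
      alt (?l xs * (?l ys - 1) + ?l x1 * (?l y1 - 1)) (f (x1 @ g y1 # x2 @ h ys # zs))) =
      beside f g h vs"
    unfolding beside_def splits_assoc
    by (rule sum.cong[OF refl], clarsimp, rule sum.cong[OF refl])
       (auto intro!: alt_cong simp: splits_def algebra_simps)
  finally show ?thesis by simp
qed

text \<open>By \<open>cmp_cmp\<close> both associators consist of the same two \<open>beside\<close>
  terms; exchanging \<open>g\<close> and \<open>h\<close> swaps them up to the sign of
  \<open>d * e\<close>.\<close>

lemma pre_Lie:
  assumes f: "multi s f" and g: "g \<in> maps s d" and h: "h \<in> maps s e"
  shows "cmp (cmp f g) h - cmp f (cmp g h) =
    alt (d * e) (cmp (cmp f h) g - cmp f (cmp h g))"
proof
  fix vs
  show "(cmp (cmp f g) h - cmp f (cmp g h)) vs =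
      alt (d * e) (cmp (cmp f h) g - cmp f (cmp h g)) vs"
    by (simp add: alt_apply cmp_cmp[OF f g h] cmp_cmp[OF f h g] alt_add mult.commute[of e d])
       (simp add: alt_def)
qed

lemma cmp_maps:
  assumes V: "vector_space s" and f: "f \<in> maps s d" and g: "g \<in> maps s e"
  shows "cmp f g \<in> maps s (d + e)"
proof -
  interpret vector_space s by (rule V)
  note mf = maps_multi[OF f] and mg = maps_multi[OF g]
  have sa: "s c (alt m x) = alt m (s c x)" for c m x
    by (simp add: alt_def)
  \<comment> \<open>In \<open>cmp_marked\<close> the variable letter and the value of
    \<open>g\<close> stand in two different slots of \<open>f\<close>.\<close>
  have fa: "f (xs @ (y + z) # t @ v # zs) = f (xs @ y # t @ v # zs) + f (xs @ z # t @ v # zs)"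
    "f (xs @ v # t @ (y + z) # zs) = f (xs @ v # t @ y # zs) + f (xs @ v # t @ z # zs)"
    "f (xs @ s c y # t @ v # zs) = s c (f (xs @ y # t @ v # zs))"
    "f (xs @ v # t @ s c y # zs) = s c (f (xs @ v # t @ y # zs))" for c xs y z t v zs
    using multi_add[OF mf, of xs y z "t @ v # zs"] multi_add[OF mf, of "xs @ v # t" y z zs]
      multi_scale[OF mf, of xs c y "t @ v # zs"] multi_scale[OF mf, of "xs @ v # t" c y zs]
    by simp_all
  have "multi s (cmp f g)"
    unfolding multi_def cmp_marked
    by (auto simp: fa multi_add[OF mf] multi_scale[OF mf] multi_add[OF mg] multi_scale[OF mg]
        alt_add sum.distrib scale_sum_right scale_right_distrib sa case_prod_unfold)
  moreover have "cmp f g vs = 0" if "int (length vs) \<noteq> d + e + 1" for vs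
    unfolding cmp_def
  proof (intro sum.neutral ballI, clarify)
    fix xs ys zs assume "(xs, ys, zs) \<in> splits vs"
    then have "int (length xs) + int (length ys) + int (length zs) \<noteq> d + e + 1"
      using that by (auto simp: splits_def)
    then have "int (length ys) \<noteq> e + 1 \<or> int (length (xs @ g ys # zs)) \<noteq> d + 1"
      by auto
    then have "f (xs @ g ys # zs) = 0"
      using maps_len[OF f] maps_len[OF g] multi_0[OF mf] by metis
    then show "alt (int (length xs) * (int (length ys) - 1)) (f (xs @ g ys # zs)) = 0" by simp
  qed
  ultimately show ?thesis by (simp add: maps_def)
qed

lemma cmp_add_left: "cmp (f + f') g = cmp f g + cmp f' g"
  and cmp_diff_left: "cmp (f - f') g = cmp f g - cmp f' g"
  and cmp_alt_left: "cmp (alt e f) g = alt e (cmp f g)"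
  and cmp_0_left: "cmp 0 g = 0"
  by (auto simp: fun_eq_iff cmp_def alt_add alt_minus alt_diff sum.distrib case_prod_unfold sum_negf
      sum_subtractf alt_apply alt_sum add.commute[of e])

lemma cmp_add_right: "multi s f \<Longrightarrow> cmp f (g + g') = cmp f g + cmp f g'"
  and cmp_alt_right: "multi s f \<Longrightarrow> cmp f (alt e g) = alt e (cmp f g)"
  and cmp_0_right: "multi s f \<Longrightarrow> cmp f 0 = 0"
  by (auto simp: fun_eq_iff cmp_def multi_add multi_alt multi_0 alt_add sum.distrib case_prod_unfold
      alt_apply alt_sum add.commute[of e])

lemma cmp_diff_right:
  assumes f: "multi s f" shows "cmp f (g - g') = cmp f g - cmp f g'"
  using cmp_add_right[OF f, of g "alt 1 g'"] cmp_alt_right[OF f, of 1 g']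
  by (simp add: alt_def)

section \<open>Derived brackets\<close>

text \<open>Exponent of the sign that rearranging skew-symmetric arguments of degrees \<open>ds\<close> into the
  order \<open>zs\<close> produces.\<close>

fun inv_exp :: "(nat \<Rightarrow> int) \<Rightarrow> nat list \<Rightarrow> int" where
  "inv_exp p [] = 0"
| "inv_exp p (z # zs) = (\<Sum>y\<leftarrow>filter (\<lambda>y. y < z) zs. 1 + p z * p y) + inv_exp p zs"

text \<open>An unshuffle is determined by the set of its first \<open>i\<close> values, a
  subsequence of \<open>[0..<n]\<close>. In this form \<open>code_simp\<close> can enumerate the
  unshuffles.\<close>

definition unshuffle_lists :: "nat \<Rightarrow> nat \<Rightarrow> nat list list" where
  "unshuffle_lists i n =
    map (\<lambda>xs. xs @ filter (\<lambda>x. x \<notin> set xs) [0..<n]) (filter (\<lambda>xs. length xs = i) (subseqs [0..<n]))"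

lemma unshuffle_lists_2_3: "unshuffle_lists 2 3 = [[0, 1, 2], [0, 2, 1], [1, 2, 0]]"
  by code_simp

lemma unshuffle_lists_2_4: "unshuffle_lists 2 4 =
    [[0, 1, 2, 3], [0, 2, 1, 3], [0, 3, 1, 2], [1, 2, 0, 3], [1, 3, 0, 2], [2, 3, 0, 1]]"
  by code_simp

lemma unshuffle_lists_3_4: "unshuffle_lists 3 4 =
    [[0, 1, 2, 3], [0, 1, 3, 2], [0, 2, 3, 1], [1, 2, 3, 0]]"
  by code_simp

lemma unshuffle_lists_3_5: "unshuffle_lists 3 5 =
    [[0, 1, 2, 3, 4], [0, 1, 3, 2, 4], [0, 1, 4, 2, 3], [0, 2, 3, 1, 4], [0, 2, 4, 1, 3],
     [0, 3, 4, 1, 2], [1, 2, 3, 0, 4], [1, 2, 4, 0, 3], [1, 3, 4, 0, 2], [2, 3, 4, 0, 1]]"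
  by code_simp

text \<open>Since everything of weight 2 vanishes, the elements of weight 1 form an abelian
  subalgebra.\<close>

locale weighted_lie =
  fixes G :: "int \<Rightarrow> int \<Rightarrow> 'g::ab_group_add set" and br :: "'g \<Rightarrow> 'g \<Rightarrow> 'g"
  assumes zero: "0 \<in> G d w"
    and add: "x \<in> G d w \<Longrightarrow> y \<in> G d w \<Longrightarrow> x + y \<in> G d w"
    and uminus: "x \<in> G d w \<Longrightarrow> - x \<in> G d w"
    and br: "x \<in> G d v \<Longrightarrow> y \<in> G e w \<Longrightarrow> br x y \<in> G (d + e) (v + w)"
    and br_add_left: "x \<in> G d v \<Longrightarrow> x' \<in> G d v \<Longrightarrow> y \<in> G e w \<Longrightarrow> br (x + x') y = br x y + br x' y"
    and skew: "x \<in> G d v \<Longrightarrow> y \<in> G e w \<Longrightarrow> br x y = - alt (d * e) (br y x)"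
    and jacobi: "x \<in> G d u \<Longrightarrow> y \<in> G e v \<Longrightarrow> z \<in> G k w \<Longrightarrow>
      br (br x y) z = br x (br y z) + alt (e * k) (br (br x z) y)"
    and top: "x \<in> G d 2 \<Longrightarrow> x = 0"
    and torsion_free: "x + x = (0::'g) \<Longrightarrow> x = 0"
begin

lemma alt_closed: "x \<in> G d w \<Longrightarrow> alt e x \<in> G d w"
  by (simp add: alt_def uminus)

lemma br_0_left: "y \<in> G e w \<Longrightarrow> br 0 y = 0"
  using br_add_left[of 0 0 0 0 y e w] zero by simp

lemma br_0_right: "y \<in> G e w \<Longrightarrow> br y 0 = 0"
  using skew[of y e w 0 0 0] br_0_left[of y e w] zero by simp

lemma br_alt_left:
  assumes "x \<in> G d v" "y \<in> G e w" shows "br (alt k x) y = alt k (br x y)"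
proof -
  have "br x y + br (- x) y = 0"
    using br_add_left[of x d v "- x" y e w] assms uminus br_0_left[of y e w] by simp
  then show ?thesis by (simp add: alt_def add_eq_0_iff)
qed

lemma br_alt_right:
  assumes "x \<in> G d v" "y \<in> G e w" shows "br x (alt k y) = alt k (br x y)"
  using skew[OF assms] skew[OF assms(1) alt_closed[OF assms(2)], of k]
    br_alt_left[OF assms(2,1), of k] by (simp add: alt_minus add.commute)

text \<open>The third term of the Jacobi identity contains \<open>br x y\<close>, which has weight
  2.\<close>

lemma commute:
  assumes "u \<in> G c v" "x \<in> G d 1" "y \<in> G e 1"
  shows "br (br u x) y = alt (d * e) (br (br u y) x)"
proof -
  have "br x y = 0" using br[OF assms(2,3)] by (intro top[of _ "d + e"]) simp
  then show ?thesis using jacobi[OF assms] br_0_right[OF assms(1)] by simp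
qed

end

locale derived_brackets = weighted_lie G br
  for G :: "int \<Rightarrow> int \<Rightarrow> 'g::ab_group_add set" and br +
  fixes \<Theta> H :: 'g
  assumes \<Theta>: "\<Theta> \<in> G 1 (- 1)" and H: "H \<in> G 1 (- 2)"
    and \<Theta>_\<Theta>: "br \<Theta> \<Theta> = 0" and \<Theta>_H: "br \<Theta> H = 0" and H_H: "br H H = 0"
begin

text \<open>The arguments have degrees \<open>p - 1\<close>, \<open>q - 1\<close>, \<dots>; the signs turn brackets that are graded
  symmetric for these degrees into brackets that are graded skew-symmetric for \<open>p\<close>, \<open>q\<close>, \<dots>.\<close>

definition m2 :: "int \<Rightarrow> 'g \<Rightarrow> 'g \<Rightarrow> 'g" where
  "m2 p x y = alt p (br (br \<Theta> x) y)"

text \<open>The shift of degrees accounts for \<open>q\<close>. The additional 1 is a global sign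
  that the Jacobi identities do not determine, as \<open>m3\<close> occurs in each of them with
  constant multiplicity 0, 1 or 2; it is chosen to match \<open>ternary_bracket\<close>.\<close>

definition m3 :: "int \<Rightarrow> 'g \<Rightarrow> 'g \<Rightarrow> 'g \<Rightarrow> 'g" where
  "m3 q x y z = alt (q + 1) (br (br (br H x) y) z)"

lemma m2_closed: "x \<in> G (p - 1) 1 \<Longrightarrow> y \<in> G (q - 1) 1 \<Longrightarrow> m2 k x y \<in> G (p + q - 1) 1"
  unfolding m2_def using br[OF br[OF \<Theta>]] by (fastforce intro!: alt_closed simp: algebra_simps)

lemma m3_closed:
  assumes "x \<in> G (p - 1) 1" "y \<in> G (q - 1) 1" "z \<in> G (r - 1) 1"
  shows "m3 k x y z \<in> G (p + q + r - 2) 1"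
  unfolding m3_def using br[OF br[OF br[OF H assms(1)] assms(2)] assms(3)]
  by (intro alt_closed) (simp add: algebra_simps)

text \<open>\<open>commute\<close> contributes \<open>(p - 1) * (q - 1)\<close> and the two
  prefactors \<open>p + q\<close>; the sum is \<open>1 + p * q\<close>.\<close>

lemma m2_skew:
  assumes "x \<in> G (p - 1) 1" "y \<in> G (q - 1) 1"
  shows "m2 q y x = alt (1 + p * q) (m2 p x y)"
  unfolding m2_def commute[OF \<Theta> assms(2,1)] by (simp add: alt_def)

lemma m3_skew_left:
  assumes "x \<in> G (p - 1) 1" "y \<in> G (q - 1) 1" "z \<in> G (r - 1) 1"
  shows "m3 p y x z = alt (1 + p * q) (m3 q x y z)"
  unfolding m3_def commute[OF H assms(2,1)]
    br_alt_left[OF br[OF br[OF H assms(1)] assms(2)] assms(3)] by (simp add: alt_def)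

lemma m3_skew_right:
  assumes "x \<in> G (p - 1) 1" "y \<in> G (q - 1) 1" "z \<in> G (r - 1) 1"
  shows "m3 r x z y = alt (1 + q * r) (m3 q x y z)"
  unfolding m3_def commute[OF br[OF H assms(1)] assms(3,2)] by (simp add: alt_def)

end

section \<open>Leibniz expansions and the Jacobi identities of the derived brackets\<close>

locale derived_brackets_elements = derived_brackets G br \<Theta> H
  for G :: "int \<Rightarrow> int \<Rightarrow> 'g::ab_group_add set" and br \<Theta> H +
  fixes x :: "nat \<Rightarrow> 'g" and p :: "nat \<Rightarrow> int"
  assumes x: "x i \<in> G (p i - 1) 1"
begin

text \<open>The expansion of $[\dots[[u, v], x_{i_1}], \dots, x_{i_k}]$ by the Leibniz rule, where \<open>v\<close> has
  degree \<open>e\<close>.\<close>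

fun leibniz :: "'g \<Rightarrow> int \<Rightarrow> 'g \<Rightarrow> nat list \<Rightarrow> 'g" where
  "leibniz u e v [] = br u v"
| "leibniz u e v (i # is) = leibniz u (e + (p i - 1)) (br v (x i)) is +
    alt (e * (p i - 1)) (leibniz (br u (x i)) e v is)"

text \<open>By the Jacobi identity the expansion equals \<open>br u u'\<close> bracketed with the
  given \<open>x i\<close> in turn. One Jacobi step produces a signed sum, hence the induction needs
  the iterated bracket to be additive and compatible with signs.\<close>

lemma leibniz_0:
  assumes "u \<in> G d v" "u' \<in> G e w" "br u u' = 0"
  shows "leibniz u e u' is = 0"
proof -
  have fold: "foldl (\<lambda>z i. br z (x i)) z is \<in> G (d + (\<Sum>i\<leftarrow>is. p i - 1)) (w + int (length is))"
    if "z \<in> G d w" for z d w "is"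
    using that
  proof (induction "is" arbitrary: z d w)
    case (Cons i "is")
    from Cons.IH[OF br[OF Cons.prems x]] show ?case by (simp add: algebra_simps)
  qed simp
  have fold_alt: "foldl (\<lambda>z i. br z (x i)) (alt k z) is = alt k (foldl (\<lambda>z i. br z (x i)) z is)"
    if "z \<in> G d w" for z d w "is" k
    using that
    by (induction "is" arbitrary: z d w) (auto simp: br_alt_left[OF _ x] intro: br[OF _ x])
  have fold_add: "foldl (\<lambda>z i. br z (x i)) (z + z') is =
      foldl (\<lambda>z i. br z (x i)) z is + foldl (\<lambda>z i. br z (x i)) z' is"
    if "z \<in> G d w" "z' \<in> G d w" for z z' d w "is"
    using that
  proof (induction "is" arbitrary: z z' d w)
    case (Cons i "is")
    from Cons.IH[OF br[OF Cons.prems(1) x] br[OF Cons.prems(2) x]] show ?case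
      by (simp add: br_add_left[OF Cons.prems x])
  qed simp
  have "leibniz u e u' is = foldl (\<lambda>z i. br z (x i)) (br u u') is"
    using assms(1,2)
  proof (induction "is" arbitrary: u u' d e v w)
    case (Cons i "is")
    note c1 = br[OF Cons.prems(1) br[OF Cons.prems(2) x[of i]]]
    note c2 = br[OF br[OF Cons.prems(1) x[of i]] Cons.prems(2)]
    have c2': "alt (e * (p i - 1)) (br (br u (x i)) u') \<in> G (d + (e + (p i - 1))) (v + (w + 1))"
      using alt_closed[OF c2] by (simp add: algebra_simps)
    show ?case
      using Cons.IH[OF Cons.prems(1) br[OF Cons.prems(2) x[of i]]]
        Cons.IH[OF br[OF Cons.prems(1) x[of i]] Cons.prems(2)]
      by (simp add: jacobi[OF Cons.prems x] fold_add[OF c1 c2'] fold_alt[OF c2])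
  qed simp
  moreover have "foldl (\<lambda>z i. br z (x i)) 0 is = 0"
    by (induction "is") (simp_all add: br_0_left[OF x])
  ultimately show ?thesis using assms(3) by simp
qed

lemma \<Theta>1: "br \<Theta> (x i) \<in> G (p i) 0"
  using br[OF \<Theta> x[of i]] by simp

lemma \<Theta>2: "br (br \<Theta> (x i)) (x j) \<in> G (p i + p j - 1) 1"
  using br[OF \<Theta>1[of i] x[of j]] by (simp add: algebra_simps)

lemma \<Theta>3: "br (br (br \<Theta> (x i)) (x j)) (x k) = 0"
  using br[OF \<Theta>2[of i j] x[of k]] by (intro top) simp

lemma H1: "br H (x i) \<in> G (p i) (- 1)"
  using br[OF H x[of i]] by simp

lemma H2: "br (br H (x i)) (x j) \<in> G (p i + p j - 1) 0"
  using br[OF H1[of i] x[of j]] by (simp add: algebra_simps)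

lemma H3: "br (br (br H (x i)) (x j)) (x k) \<in> G (p i + p j + p k - 2) 1"
  using br[OF H2[of i j] x[of k]] by (simp add: algebra_simps)

lemma H4: "br (br (br (br H (x i)) (x j)) (x k)) (x l) = 0"
  using br[OF H3[of i j k] x[of l]] by (intro top) simp

text \<open>These facts discard each Leibniz term in which \<Theta> receives three arguments or H
  four: the weights would be -1 + 3 = 2 and -2 + 4 = 2.\<close>

lemmas zeros = \<Theta>3 H4 br_0_left[OF x] br_0_left[OF \<Theta>] br_0_left[OF H] br_0_left[OF \<Theta>1]
  br_0_left[OF H1] br_0_left[OF \<Theta>2] br_0_left[OF H2] br_0_left[OF H3]
  br_0_right[OF \<Theta>] br_0_right[OF H] br_0_right[OF \<Theta>1] br_0_right[OF H1] br_0_right[OF \<Theta>2]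

text \<open>In the expansion of the bracket of \<Theta> with itself, the six surviving terms put one
  argument on one copy of \<Theta> and two on the other. Skew-symmetry identifies them in pairs, so
  twice the claimed sum is zero.\<close>

lemma jacobi_3:
  "(\<Sum>zs\<leftarrow>unshuffle_lists 2 3. alt (inv_exp p zs)
    (m2 (p (zs ! 0) + p (zs ! 1)) (m2 (p (zs ! 0)) (x (zs ! 0)) (x (zs ! 1))) (x (zs ! 2)))) = 0"
  (is "?T = 0")
proof -
  have skew': "br (br (br \<Theta> (x i)) (x j)) (br \<Theta> (x k)) =
      alt (1 + (p i + p j - 1) * p k) (br (br \<Theta> (x k)) (br (br \<Theta> (x i)) (x j)))" for i j k
    using skew[OF \<Theta>2[of i j] \<Theta>1[of k]] by (simp add: alt_def)
  \<comment> \<open>The inner bracket has weight 1 itself, so \<open>commute\<close> moves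
    \<open>x k\<close> in front of it. The result has the shape of a Leibniz term.\<close>
  have nested: "m2 e (m2 f (x i) (x j)) (x k) =
      alt (e + f + (p i + p j - 1) * (p k - 1)) (br (br \<Theta> (x k)) (br (br \<Theta> (x i)) (x j)))"
    for e f i j k
    unfolding m2_def br_alt_right[OF \<Theta> \<Theta>2] br_alt_left[OF br[OF \<Theta> \<Theta>2] x] commute[OF \<Theta> \<Theta>2 x]
    by (simp add: add_ac)
  \<comment> \<open>For the identity unshuffle the prefactors in \<open>nested\<close> add up to
    \<open>2 * p 0 + p 1\<close>; multiplication by the sign of \<open>p 1\<close> clears
    them.\<close>
  have "alt (p 1) ?T + alt (p 1) ?T = leibniz \<Theta> 1 \<Theta> [0, 1, 2]"
    by (simp add: unshuffle_lists_2_3 zeros nested skew' alt_add)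
       (cases "even (p 0)"; cases "even (p 1)"; cases "even (p 2)"; simp add: alt_def add_ac)
  then have "alt (p 1) ?T = 0"
    unfolding leibniz_0[OF \<Theta> \<Theta> \<Theta>_\<Theta>] by (rule torsion_free)
  then show ?thesis by (simp only: alt_eq_0_iff)
qed

text \<open>Here the two products differ, so every summand occurs once. Six terms with two arguments
  on each product give \<open>l_3(l_2)\<close>; four terms with one argument on \<Theta> and three
  on H give \<open>l_2(l_3)\<close>. The minus sign is \<open>(- 1) ^ (i * (j - 1))\<close> for i =
  3 and j = 2.\<close>

lemma jacobi_4:
  "(\<Sum>zs\<leftarrow>unshuffle_lists 2 4. alt (inv_exp p zs)
     (m3 (p (zs ! 2)) (m2 (p (zs ! 0)) (x (zs ! 0)) (x (zs ! 1))) (x (zs ! 2)) (x (zs ! 3)))) -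
   (\<Sum>zs\<leftarrow>unshuffle_lists 3 4. alt (inv_exp p zs)
     (m2 (p (zs ! 0) + p (zs ! 1) + p (zs ! 2) - 1)
       (m3 (p (zs ! 1)) (x (zs ! 0)) (x (zs ! 1)) (x (zs ! 2))) (x (zs ! 3)))) = 0"
  (is "?T = 0")
proof -
  have nested1: "m2 e (m3 f (x i) (x j) (x k)) (x l) =
      alt (e + f + 1 + (p i + p j + p k - 2) * (p l - 1))
        (br (br \<Theta> (x l)) (br (br (br H (x i)) (x j)) (x k)))" for e f i j k l
    unfolding m2_def m3_def br_alt_right[OF \<Theta> H3] br_alt_left[OF br[OF \<Theta> H3] x]
      commute[OF \<Theta> H3 x] by (simp add: add_ac)
  \<comment> \<open>\<open>commute\<close> is applied twice to bring \<open>x k\<close> and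
    \<open>x l\<close> next to H; skew-symmetry then puts the factor with \<Theta> on the left, as
    in the expansion.\<close>
  have nested2: "m3 e (m2 f (x i) (x j)) (x k) (x l) =
      alt (e + f + (p i + p j - 1) * (p k + p l - 2) + (p i + p j - 1) * (p k + p l - 1))
        (br (br (br \<Theta> (x i)) (x j)) (br (br H (x k)) (x l)))" for e f i j k l
    unfolding m2_def m3_def br_alt_right[OF H \<Theta>2] br_alt_left[OF br[OF H \<Theta>2] x]
      commute[OF H \<Theta>2 x] commute[OF H1 \<Theta>2 x] skew[OF H2 \<Theta>2] alt_alt
      br_alt_left[OF br[OF H1 \<Theta>2] x] br_alt_left[OF br[OF br[OF H \<Theta>2] x] x]
    by (auto simp: alt_def)
  have "alt (p 0 + p 2 + 1) ?T = leibniz \<Theta> 1 H [0, 1, 2, 3]"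
    by (simp add: unshuffle_lists_2_4 unshuffle_lists_3_4 zeros nested1 nested2 alt_add alt_diff)
       (cases "even (p 0)"; cases "even (p 1)"; cases "even (p 2)"; cases "even (p 3)";
        simp add: alt_def add_ac)
  then have "alt (p 0 + p 2 + 1) ?T = 0"
    by (simp only: leibniz_0[OF \<Theta> H \<Theta>_H])
  then show ?thesis by (simp only: alt_eq_0_iff)
qed

text \<open>Two copies of H share five arguments, at most three each: the twenty terms of type 2 + 3
  and 3 + 2 are the ten unshuffles, each counted twice.\<close>

lemma jacobi_5:
  "(\<Sum>zs\<leftarrow>unshuffle_lists 3 5. alt (inv_exp p zs)
    (m3 (p (zs ! 3)) (m3 (p (zs ! 1)) (x (zs ! 0)) (x (zs ! 1)) (x (zs ! 2)))
      (x (zs ! 3)) (x (zs ! 4)))) = 0"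
  (is "?T = 0")
proof -
  have skew': "br (br (br (br H (x i)) (x j)) (x k)) (br (br H (x l)) (x m)) =
      alt (1 + (p i + p j + p k - 2) * (p l + p m - 1))
        (br (br (br H (x l)) (x m)) (br (br (br H (x i)) (x j)) (x k)))" for i j k l m
    using skew[OF H3[of i j k] H2[of l m]] by (simp add: alt_def)
  have nested: "m3 e (m3 f (x i) (x j) (x k)) (x l) (x m) =
      alt (e + f + (p i + p j + p k - 2) * (p l + p m - 2))
        (br (br (br H (x l)) (x m)) (br (br (br H (x i)) (x j)) (x k)))" for e f i j k l m
    unfolding m3_def br_alt_right[OF H H3] br_alt_left[OF br[OF H H3] x]
      commute[OF H H3 x] commute[OF H1 H3 x]
      alt_alt br_alt_left[OF br[OF H1 H3] x] br_alt_left[OF br[OF br[OF H H3] x] x]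
    by (auto simp: alt_def)
  have "alt (p 1 + p 3) ?T + alt (p 1 + p 3) ?T = leibniz H 1 H [0, 1, 2, 3, 4]"
    by (simp add: unshuffle_lists_3_5 zeros nested skew' alt_add)
       (cases "even (p 0)"; cases "even (p 1)"; cases "even (p 2)"; cases "even (p 3)";
        cases "even (p 4)"; simp add: alt_def add_ac)
  then have "alt (p 1 + p 3) ?T = 0"
    unfolding leibniz_0[OF H H H_H] by (rule torsion_free)
  then show ?thesis by (simp only: alt_eq_0_iff)
qed

end

section \<open>Signs of permutations and unshuffles\<close>

definition inversions :: "nat \<Rightarrow> (nat \<Rightarrow> nat) \<Rightarrow> (nat \<times> nat) set" where
  "inversions n \<sigma> = {(a, b). a < b \<and> b < n \<and> \<sigma> b < \<sigma> a}"

lemma finite_inversions [simp]: "finite (inversions n \<sigma>)"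
  by (rule finite_subset[of _ "{..<n} \<times> {..<n}"]) (auto simp: inversions_def)

lemma permutes_map_upt:
  assumes "\<sigma> permutes {..<n}"
  shows "distinct (map \<sigma> [0..<n])" "set (map \<sigma> [0..<n]) = {..<n}"
  using permutes_inj_on[OF assms] permutes_image[OF assms]
  by (simp_all add: distinct_map atLeast_upt)

text \<open>Bubble sort: composing with the adjacent transposition at a descent removes exactly one
  inversion and flips the sign, and a permutation without descents is the identity.\<close>

lemma sign_inversions:
  assumes "\<sigma> permutes {..<n}" shows "sign \<sigma> = (- 1) ^ card (inversions n \<sigma>)"
  using assms
proof (induction "card (inversions n \<sigma>)" arbitrary: \<sigma> rule: less_induct)
  case less
  show ?case
  proof (cases "\<exists>k. Suc k < n \<and> \<sigma> (Suc k) < \<sigma> k")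
    case True
    then obtain k where k: "Suc k < n" "\<sigma> (Suc k) < \<sigma> k" by blast
    define \<tau> where "\<tau> = transpose k (Suc k)"
    have \<tau>: "\<tau> permutes {..<n}"
      unfolding \<tau>_def using k by (intro permutes_swap_id) auto
    have \<tau>\<tau>: "\<tau> (\<tau> a) = a" for a by (simp add: \<tau>_def)
    \<comment> \<open>An adjacent transposition preserves the order of every pair except the one it
      exchanges, so applying it to both positions matches all other inversions.\<close>
    have mono: "\<tau> a < \<tau> b" if "a < b" "(a, b) \<noteq> (k, Suc k)" for a b
      using that by (auto simp: \<tau>_def transpose_def)
    have bound: "\<tau> b < n" if "b < n" for b
      using that k by (auto simp: \<tau>_def transpose_def)
    have bij: "bij_betw (map_prod \<tau> \<tau>) (inversions n (\<sigma> \<circ> \<tau>)) (inversions n \<sigma> - {(k, Suc k)})"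
    proof (rule bij_betw_byWitness[of _ "map_prod \<tau> \<tau>"])
      show "map_prod \<tau> \<tau> ` inversions n (\<sigma> \<circ> \<tau>) \<subseteq> inversions n \<sigma> - {(k, Suc k)}"
      proof (rule image_subsetI, unfold split_paired_all)
        fix a b assume ab: "(a, b) \<in> inversions n (\<sigma> \<circ> \<tau>)"
        have "(a, b) \<noteq> (k, Suc k)"
          using ab k by (auto simp: inversions_def \<tau>_def)
        then have "(\<tau> a, \<tau> b) \<in> inversions n \<sigma>"
          using ab mono bound by (auto simp: inversions_def)
        moreover have "(\<tau> a, \<tau> b) \<noteq> (k, Suc k)"
        proof
          assume "(\<tau> a, \<tau> b) = (k, Suc k)"
          then have "a = \<tau> k" "b = \<tau> (Suc k)"
            using \<tau>\<tau>[of a] \<tau>\<tau>[of b] by simp_all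
          then have "a = Suc k" "b = k" by (simp_all add: \<tau>_def)
          then show False using ab by (auto simp: inversions_def)
        qed
        ultimately show "map_prod \<tau> \<tau> (a, b) \<in> inversions n \<sigma> - {(k, Suc k)}" by simp
      qed
      show "map_prod \<tau> \<tau> ` (inversions n \<sigma> - {(k, Suc k)}) \<subseteq> inversions n (\<sigma> \<circ> \<tau>)"
        using mono bound by (auto simp: inversions_def \<tau>\<tau>)
    qed (auto simp: \<tau>\<tau>)
    have "(k, Suc k) \<in> inversions n \<sigma>" using k by (simp add: inversions_def)
    then have card: "card (inversions n \<sigma>) = Suc (card (inversions n (\<sigma> \<circ> \<tau>)))"
      using bij_betw_same_card[OF bij] by (metis card_Suc_Diff1 finite_inversions)
    have "sign (\<sigma> \<circ> \<tau>) = sign \<sigma> * sign \<tau>"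
      using less.prems \<tau> by (intro sign_compose) (auto simp: permutation_permutes)
    also have "sign \<tau> = - 1" by (simp add: \<tau>_def sign_swap_id)
    finally have "sign \<sigma> = - sign (\<sigma> \<circ> \<tau>)" by (simp add: o_def)
    also have "sign (\<sigma> \<circ> \<tau>) = (- 1) ^ card (inversions n (\<sigma> \<circ> \<tau>))"
      using less.prems \<tau> by (intro less.hyps) (auto simp: card permutes_compose)
    finally show ?thesis by (simp add: card)
  next
    case False
    then have "sorted (map \<sigma> [0..<n])"
      by (auto simp: sorted_iff_nth_Suc)
    moreover have "sorted [0..<n]" "distinct [0..<n]" "set [0..<n] = {..<n}"
      by (auto simp: atLeast_upt)
    ultimately have eq: "map \<sigma> [0..<n] = [0..<n]"
      using permutes_map_upt[OF less.prems] by (intro sorted_distinct_set_unique) simp_all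
    have "\<sigma> i = i" for i
    proof (cases "i < n")
      case True
      then show ?thesis using arg_cong[OF eq, of "\<lambda>xs. xs ! i"] by simp
    next
      case False
      then show ?thesis using permutes_not_in[OF less.prems] by simp
    qed
    then have "\<sigma> = id" by auto
    moreover have "inversions n id = {}" by (auto simp: inversions_def)
    ultimately show ?thesis by simp
  qed
qed

text \<open>The head of the list accounts for the inversions at position 0; those of the tail are
  shifted by one.\<close>

lemma inv_exp_sum:
  "inv_exp p zs = (\<Sum>(a, b)\<in>{(a, b). a < b \<and> b < length zs \<and> zs ! b < zs ! a}.
    1 + p (zs ! a) * p (zs ! b))"
proof (induction zs)
  case Nil
  then show ?case by simp
next
  case (Cons z zs)
  let ?I = "\<lambda>zs. {(a, b). a < b \<and> b < length zs \<and> (zs ! b :: nat) < zs ! a}"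
  have fin: "finite (map_prod Suc Suc ` ?I zs)"
    by (rule finite_imageI, rule finite_subset[of _ "{..<length zs} \<times> {..<length zs}"]) auto
  have I: "?I (z # zs) = (\<lambda>b. (0, Suc b)) ` {b. b < length zs \<and> zs ! b < z} \<union> map_prod Suc Suc ` ?I zs"
  proof (intro equalityI subsetI)
    fix s assume "s \<in> ?I (z # zs)"
    then obtain a b where "s = (a, b)" "a < b" "b < Suc (length zs)" "(z # zs) ! b < (z # zs) ! a"
      by auto
    then show "s \<in> (\<lambda>b. (0, Suc b)) ` {b. b < length zs \<and> zs ! b < z} \<union> map_prod Suc Suc ` ?I zs"
      by (cases a; cases b) (auto simp: image_iff)
  qed auto
  have "(\<Sum>y\<leftarrow>filter (\<lambda>y. y < z) zs. 1 + p z * p y) =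
      (\<Sum>b<length zs. if zs ! b < z then 1 + p z * p (zs ! b) else 0)"
    unfolding sum_list_map_filter'
    by (subst sum_list_sum_nth, unfold length_map atLeast0LessThan) (rule sum.cong, simp_all)
  also have "\<dots> = (\<Sum>b\<in>{b. b < length zs \<and> zs ! b < z}. 1 + p z * p (zs ! b))"
    by (simp add: sum.If_cases lessThan_def Collect_conj_eq[symmetric])
  finally show ?case
    unfolding I
    by (subst sum.union_disjoint)
       (use fin in \<open>auto simp: Cons.IH sum.reindex inj_on_def case_prod_unfold\<close>)
qed

lemma alt_sum_one: "finite A \<Longrightarrow> alt (sum f A) (1 :: int) = (\<Prod>a\<in>A. alt (f a) 1)"
  by (induction A rule: finite_induct) (auto simp: alt_def)

text \<open>Every inversion contributes -1 to the sign of the permutation and its own factor to the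
  Koszul sign, so the product of both is one product over inversions.\<close>

lemma sign_koszul_sign:
  assumes \<sigma>: "\<sigma> permutes {..<n}" and ds: "length ds = n"
  shows "sign \<sigma> * koszul_sign ds \<sigma> = alt (inv_exp ((!) ds) (map \<sigma> [0..<n])) 1"
proof -
  have I: "{(a, b). a < b \<and> b < length (map \<sigma> [0..<n]) \<and> map \<sigma> [0..<n] ! b < map \<sigma> [0..<n] ! a} =
      inversions n \<sigma>"
    by (auto simp: inversions_def)
  have "alt (inv_exp ((!) ds) (map \<sigma> [0..<n])) 1 =
      (\<Prod>(a, b)\<in>inversions n \<sigma>. alt (1 + ds ! \<sigma> a * ds ! \<sigma> b) (1 :: int))"
    unfolding inv_exp_sum I alt_sum_one[OF finite_inversions]
    by (rule prod.cong) (auto simp: inversions_def)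
  also have "\<dots> = (\<Prod>(a, b)\<in>inversions n \<sigma>. (- 1) * alt (ds ! \<sigma> a * ds ! \<sigma> b) (1 :: int))"
    by (rule prod.cong) (auto simp: alt_def)
  also have "\<dots> = sign \<sigma> * koszul_sign ds \<sigma>"
    unfolding sign_inversions[OF \<sigma>] koszul_sign_def ds inversions_def[symmetric]
    by (simp only: case_prod_unfold prod.distrib prod_constant)
  finally show ?thesis by simp
qed

lemma sorted_wrt_subseqs: "ys \<in> set (subseqs xs) \<Longrightarrow> sorted_wrt P xs \<Longrightarrow> sorted_wrt P ys"
proof (induction xs arbitrary: ys)
  case (Cons x xs)
  have "set zs \<subseteq> set xs" if "zs \<in> set (subseqs xs)" for zs
    using that subseqs_powset[of xs] by blast
  then show ?case using Cons by (auto simp: Let_def) blast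
qed simp

text \<open>Both blocks of an unshuffle are increasing, so the second block must list the complement
  of the first in order.\<close>

lemma map_unshuffles:
  assumes "i \<le> n"
  shows "(\<lambda>\<sigma>. map \<sigma> [0..<n]) ` unshuffles i n = set (unshuffle_lists i n)"
proof (intro equalityI subsetI)
  fix zs assume "zs \<in> (\<lambda>\<sigma>. map \<sigma> [0..<n]) ` unshuffles i n"
  then obtain \<sigma> where zs: "zs = map \<sigma> [0..<n]" and \<sigma>: "\<sigma> permutes {..<n}"
    and mono: "strict_mono_on {..<i} \<sigma>" "strict_mono_on {i..<n} \<sigma>"
    by (auto simp: unshuffles_def)
  have split: "zs = map \<sigma> [0..<i] @ map \<sigma> [i..<n]"
    using upt_add_eq_append[of 0 i "n - i"] assms by (simp add: zs flip: map_append)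
  note props = permutes_map_upt[OF \<sigma>, folded zs, unfolded split]
  have "\<sigma> ` {..<i} \<subseteq> {..<n}" using props(2) by (auto simp: atLeast0LessThan)
  then have "\<sigma> ` {..<i} \<in> Pow (set [0..<n])" by auto
  then obtain ys where ys: "ys \<in> set (subseqs [0..<n])" "set ys = \<sigma> ` {..<i}"
    unfolding subseqs_powset[symmetric] by auto
  have "sorted_wrt (<) ys" by (rule sorted_wrt_subseqs[OF ys(1)]) simp
  moreover have "sorted_wrt (<) (map \<sigma> [0..<i])" "sorted_wrt (<) (map \<sigma> [i..<n])"
    using mono unfolding sorted_wrt_map
    by (auto simp: strict_mono_on_def intro!: sorted_wrt_mono_rel[OF _ sorted_wrt_upt])
  ultimately have *: "map \<sigma> [0..<i] = ys"
    by (intro strict_sorted_equal) (auto simp: ys)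
  have "sorted_wrt (<) (filter (\<lambda>x. x \<notin> set ys) [0..<n])"
    by (rule sorted_wrt_filter) simp
  then have "map \<sigma> [i..<n] = filter (\<lambda>x. x \<notin> set ys) [0..<n]"
    using \<open>sorted_wrt (<) (map \<sigma> [i..<n])\<close> props
    by (intro strict_sorted_equal) (auto simp: *[symmetric])
  then show "zs \<in> set (unshuffle_lists i n)"
    using ys(1) * by (auto simp: unshuffle_lists_def split image_iff intro!: bexI[of _ ys])
next
  fix zs assume "zs \<in> set (unshuffle_lists i n)"
  then obtain ys where ys: "ys \<in> set (subseqs [0..<n])" "length ys = i"
    and zs: "zs = ys @ filter (\<lambda>x. x \<notin> set ys) [0..<n]"
    by (auto simp: unshuffle_lists_def)
  have sorted: "sorted_wrt (<) ys" "sorted_wrt (<) (filter (\<lambda>x. x \<notin> set ys) [0..<n])"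
    by (rule sorted_wrt_subseqs[OF ys(1)] sorted_wrt_filter, simp)+
  have "set ys \<in> set ` set (subseqs [0..<n])" using ys(1) by (rule imageI)
  then have "set ys \<subseteq> {..<n}" by (simp only: subseqs_powset atLeast_upt Pow_iff)
  then have set: "set zs = {..<n}" by (auto simp: zs)
  have "distinct ys" using sorted(1) by (simp add: strict_sorted_iff)
  then have dist: "distinct zs" by (auto simp: zs)
  have len: "length zs = n" using distinct_card[OF dist] set by simp
  define \<sigma> where "\<sigma> k = (if k < n then zs ! k else k)" for k
  have bij: "bij_betw \<sigma> {..<n} {..<n}"
    using bij_betw_nth[OF dist refl refl] set len
    by (subst bij_betw_cong[of "{..<n}" \<sigma> "(!) zs"]) (simp_all add: \<sigma>_def)
  have "\<sigma> permutes {..<n}"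
    using bij by (rule bij_imp_permutes) (simp add: \<sigma>_def)
  moreover have "strict_mono_on {..<i} \<sigma>"
  proof (rule strict_mono_onI)
    fix r s assume rs: "r \<in> {..<i}" "s \<in> {..<i}" "r < s"
    then have "\<sigma> r = ys ! r" "\<sigma> s = ys ! s"
      using assms by (simp_all add: \<sigma>_def zs nth_append ys(2))
    then show "\<sigma> r < \<sigma> s" using sorted_wrt_nth_less[OF sorted(1) rs(3)] rs(2) ys(2) by simp
  qed
  moreover have "strict_mono_on {i..<n} \<sigma>"
  proof (rule strict_mono_onI)
    fix r s assume rs: "r \<in> {i..<n}" "s \<in> {i..<n}" "r < s"
    let ?ws = "filter (\<lambda>x. x \<notin> set ys) [0..<n]"
    have "\<sigma> r = ?ws ! (r - i)" "\<sigma> s = ?ws ! (s - i)"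
      using rs by (simp_all add: \<sigma>_def zs nth_append ys(2))
    moreover have "r - i < s - i" "s - i < length ?ws"
      using rs len ys(2) unfolding zs length_append by auto
    ultimately show "\<sigma> r < \<sigma> s" using sorted_wrt_nth_less[OF sorted(2)] by simp
  qed
  moreover have "zs = map \<sigma> [0..<n]"
    by (rule nth_equalityI) (auto simp: len \<sigma>_def)
  ultimately show "zs \<in> (\<lambda>\<sigma>. map \<sigma> [0..<n]) ` unshuffles i n"
    by (auto simp: unshuffles_def)
qed

text \<open>Turns a sum over permutations into a sum over an explicit list. \<open>F\<close> stands
  for the summand; distinctness is decided by evaluating the list for concrete \<open>i\<close> and
  \<open>n\<close>.\<close>

lemma sum_unshuffles:
  assumes "length xs = n" "length ds = n" "i \<le> n" "distinct (unshuffle_lists i n)"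
  shows "(\<Sum>\<sigma>\<in>unshuffles i n. F (sign \<sigma> * koszul_sign ds \<sigma>) (permute_list \<sigma> xs)) =
    (\<Sum>zs\<leftarrow>unshuffle_lists i n. F (alt (inv_exp ((!) ds) zs) 1) (map ((!) xs) zs))"
proof -
  have inj: "inj_on (\<lambda>\<sigma>. map \<sigma> [0..<n]) (unshuffles i n)"
  proof (rule inj_onI)
    fix \<sigma> \<tau> assume *: "\<sigma> \<in> unshuffles i n" "\<tau> \<in> unshuffles i n" "map \<sigma> [0..<n] = map \<tau> [0..<n]"
    have "\<sigma> k = \<tau> k" for k
      using * by (cases "k < n") (auto simp: unshuffles_def permutes_def)
    then show "\<sigma> = \<tau>" by auto
  qed
  have "(\<Sum>zs\<leftarrow>unshuffle_lists i n. F (alt (inv_exp ((!) ds) zs) 1) (map ((!) xs) zs)) =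
      (\<Sum>\<sigma>\<in>unshuffles i n. F (alt (inv_exp ((!) ds) (map \<sigma> [0..<n])) 1) (map ((!) xs) (map \<sigma> [0..<n])))"
    unfolding sum_list_distinct_conv_sum_set[OF assms(4)] map_unshuffles[OF assms(3), symmetric]
    by (simp add: sum.reindex[OF inj] o_def)
  also have "\<dots> = (\<Sum>\<sigma>\<in>unshuffles i n. F (sign \<sigma> * koszul_sign ds \<sigma>) (permute_list \<sigma> xs))"
    by (rule sum.cong)
       (auto simp: unshuffles_def sign_koszul_sign assms permute_list_def o_def)
  finally show ?thesis by simp
qed

section \<open>The weighted Lie algebra of multilinear maps\<close>

text \<open>For maps of degrees \<open>d\<close> and \<open>e\<close> this is the Gerstenhaber bracket; the sign
  $(-1)^{de}$ is hidden in the exponent, so that the bracket does not depend on degrees.\<close>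

definition brk :: "('v list \<Rightarrow> 'v) \<Rightarrow> ('v list \<Rightarrow> 'v) \<Rightarrow> 'v list \<Rightarrow> 'v::ab_group_add" where
  "brk f g vs = cmp f g vs - (\<Sum>(xs, ys, zs)\<in>splits vs.
    alt (int (length zs) * (int (length ys) - 1)) (g (xs @ f ys # zs)))"

text \<open>In a nonzero term \<open>length ys - 1\<close> is \<open>d\<close> and
  \<open>length xs + length zs\<close> is \<open>e\<close>, so the exponent with \<open>zs\<close>
  differs from the usual one with \<open>xs\<close> by \<open>d * e\<close> modulo 2.\<close>

lemma brk_eq:
  assumes f: "f \<in> maps s d" and g: "g \<in> maps s e"
  shows "brk f g = cmp f g - alt (d * e) (cmp g f)"
proof
  fix vs
  have "alt (int (length zs) * (int (length ys) - 1)) (g (xs @ f ys # zs)) =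
      alt (d * e + int (length xs) * (int (length ys) - 1)) (g (xs @ f ys # zs))" for xs ys zs
  proof (cases "int (length ys) = d + 1 \<and> int (length (xs @ f ys # zs)) = e + 1")
    case True
    then have de: "e = int (length xs) + int (length zs)" "d = int (length ys) - 1" by auto
    show ?thesis unfolding de by (intro alt_cong) (simp add: algebra_simps)
  next
    case False
    then have "g (xs @ f ys # zs) = 0"
      using maps_len[OF f] maps_len[OF g] multi_0[OF maps_multi[OF g]] by metis
    then show ?thesis by simp
  qed
  then show "brk f g vs = (cmp f g - alt (d * e) (cmp g f)) vs"
    by (simp add: brk_def cmp_def alt_apply alt_sum case_prod_unfold)
qed

section \<open>The Gerstenhaber bracket as a graded Lie bracket\<close>

context vector_space
begin

lemma maps_zero: "0 \<in> maps scale d"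
  by (simp add: maps_def multi_def)

lemma maps_add: "f \<in> maps scale d \<Longrightarrow> g \<in> maps scale d \<Longrightarrow> f + g \<in> maps scale d"
  by (simp add: maps_def multi_def scale_right_distrib)

lemma maps_uminus: "f \<in> maps scale d \<Longrightarrow> - f \<in> maps scale d"
  by (simp add: maps_def multi_def)

lemma maps_alt: "f \<in> maps scale d \<Longrightarrow> alt e f \<in> maps scale d"
  by (simp add: alt_def maps_uminus)

lemma maps_scale: "f \<in> maps scale d \<Longrightarrow> (\<lambda>vs. scale c (f vs)) \<in> maps scale d"
  by (simp add: maps_def multi_def scale_right_distrib mult.commute)

lemma scale_alt: "scale c (alt e x) = alt e (scale c x)"
  by (simp add: alt_def)

lemma cmp_closed: "f \<in> maps scale d \<Longrightarrow> g \<in> maps scale e \<Longrightarrow> cmp f g \<in> maps scale (d + e)"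
  by (rule cmp_maps[OF vector_space_axioms])

lemma maps_diff: "f \<in> maps scale d \<Longrightarrow> g \<in> maps scale d \<Longrightarrow> f - g \<in> maps scale d"
  using maps_add[OF _ maps_uminus, of f d g] by simp

lemma brk_closed:
  assumes "f \<in> maps scale d" "g \<in> maps scale e"
  shows "brk f g \<in> maps scale (d + e)"
  unfolding brk_eq[OF assms]
  using cmp_closed[OF assms] cmp_closed[OF assms(2,1)]
  by (intro maps_diff maps_alt) (simp_all add: add.commute)

lemma cmp_scale_left: "cmp (\<lambda>vs. scale c (f vs)) g vs = scale c (cmp f g vs)"
  by (simp add: cmp_def scale_sum_right scale_alt case_prod_unfold)

lemma cmp_scale_right: "multi scale f \<Longrightarrow> cmp f (\<lambda>vs. scale c (g vs)) vs = scale c (cmp f g vs)"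
  by (simp add: cmp_def scale_sum_right scale_alt case_prod_unfold multi_scale)

lemma brk_scale_left:
  assumes "f \<in> maps scale d" "g \<in> maps scale e"
  shows "brk (\<lambda>vs. scale c (f vs)) g = (\<lambda>vs. scale c (brk f g vs))"
  unfolding brk_eq[OF assms] brk_eq[OF maps_scale[OF assms(1)] assms(2)]
  by (simp add: fun_eq_iff cmp_scale_left cmp_scale_right[OF maps_multi[OF assms(2)]] alt_apply
      scale_alt scale_right_diff_distrib)

lemma brk_scale_right:
  assumes "f \<in> maps scale d" "g \<in> maps scale e"
  shows "brk f (\<lambda>vs. scale c (g vs)) = (\<lambda>vs. scale c (brk f g vs))"
  unfolding brk_eq[OF assms] brk_eq[OF assms(1) maps_scale[OF assms(2)]]
  by (simp add: fun_eq_iff cmp_scale_left cmp_scale_right[OF maps_multi[OF assms(1)]] alt_apply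
      scale_alt scale_right_diff_distrib)

lemma brk_add_left:
  assumes "f \<in> maps scale d" "f' \<in> maps scale d" "g \<in> maps scale e"
  shows "brk (f + f') g = brk f g + brk f' g"
  unfolding brk_eq[OF assms(1,3)] brk_eq[OF assms(2,3)] brk_eq[OF maps_add[OF assms(1,2)] assms(3)]
  by (simp add: cmp_add_left cmp_add_right[OF maps_multi[OF assms(3)]] alt_add)

lemma brk_add_right:
  assumes "f \<in> maps scale d" "g \<in> maps scale e" "g' \<in> maps scale e"
  shows "brk f (g + g') = brk f g + brk f g'"
  unfolding brk_eq[OF assms(1,2)] brk_eq[OF assms(1,3)] brk_eq[OF assms(1) maps_add[OF assms(2,3)]]
  by (simp add: cmp_add_left cmp_add_right[OF maps_multi[OF assms(1)]] alt_add)

text \<open>The graded commutator of a pre-Lie product satisfies Jacobi: the pre-Lie identity is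
  used once for each choice of the outermost map, after which all terms cancel for each choice of
  parities.\<close>

lemma brk_jacobi:
  assumes f: "f \<in> maps scale d" and g: "g \<in> maps scale e" and h: "h \<in> maps scale k"
  shows "brk (brk f g) h = brk f (brk g h) + alt (e * k) (brk (brk f h) g)"
proof -
  note mf = maps_multi[OF f] and mg = maps_multi[OF g] and mh = maps_multi[OF h]
  note lin = cmp_diff_left cmp_alt_left cmp_diff_right[OF mf] cmp_diff_right[OF mg]
    cmp_diff_right[OF mh] cmp_alt_right[OF mf] cmp_alt_right[OF mg] cmp_alt_right[OF mh]
  have 1: "cmp (cmp f g) h = cmp f (cmp g h) + alt (e * k) (cmp (cmp f h) g - cmp f (cmp h g))"
    using pre_Lie[OF mf g h] by (simp add: algebra_simps)
  have 2: "cmp (cmp g f) h = cmp g (cmp f h) + alt (d * k) (cmp (cmp g h) f - cmp g (cmp h f))"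
    using pre_Lie[OF mg f h] by (simp add: algebra_simps)
  have 3: "cmp (cmp h f) g = cmp h (cmp f g) + alt (d * e) (cmp (cmp h g) f - cmp h (cmp g f))"
    using pre_Lie[OF mh f g] by (simp add: algebra_simps)
  show ?thesis
    unfolding brk_eq[OF brk_closed[OF f g] h] brk_eq[OF f brk_closed[OF g h]]
      brk_eq[OF brk_closed[OF f h] g]
    unfolding brk_eq[OF f g] brk_eq[OF g h] brk_eq[OF f h] lin 1 2 3
    by (cases "even d"; cases "even e"; cases "even k"; simp add: alt_def)
qed

end

text \<open>The component of weight \<open>k\<close> of \<open>A \<oplus> M\<close>: the weight of a letter counts its occurrences
  of \<open>A\<close>. A map of weight \<open>w\<close> raises the weight by \<open>w\<close>.\<close>

definition weight_space :: "int \<Rightarrow> ('a::ab_group_add \<times> 'a) set" where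
  "weight_space k = {v. (k \<noteq> 1 \<longrightarrow> fst v = 0) \<and> (k \<noteq> 0 \<longrightarrow> snd v = 0)}"

definition has_weight :: "int \<Rightarrow> (('a::ab_group_add \<times> 'a) list \<Rightarrow> 'a \<times> 'a) \<Rightarrow> bool" where
  "has_weight w f \<longleftrightarrow> (\<forall>ks vs. list_all2 (\<lambda>k v. v \<in> weight_space k) ks vs \<longrightarrow>
    f vs \<in> weight_space (sum_list ks + w))"

lemma weight_space_zero [simp]: "0 \<in> weight_space k"
  and weight_space_add: "u \<in> weight_space k \<Longrightarrow> v \<in> weight_space k \<Longrightarrow> u + v \<in> weight_space k"
  and weight_space_alt: "u \<in> weight_space k \<Longrightarrow> alt e u \<in> weight_space k"
  by (simp_all add: weight_space_def alt_def)

lemma weight_space_sum: "(\<And>a. a \<in> A \<Longrightarrow> f a \<in> weight_space k) \<Longrightarrow> sum f A \<in> weight_space k"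
  by (induction A rule: infinite_finite_induct) (auto intro: weight_space_add)

lemma has_weight_cmp:
  assumes f: "has_weight v f" and g: "has_weight w g"
  shows "has_weight (v + w) (cmp f g)"
  unfolding has_weight_def cmp_def
proof (intro allI impI weight_space_sum, clarify, intro weight_space_alt)
  fix ks :: "int list" and vs xs ys zs :: "('a \<times> 'a) list"
  assume "list_all2 (\<lambda>k v. v \<in> weight_space k) ks vs" "(xs, ys, zs) \<in> splits vs"
  then obtain ks1 ks2 ks3 where ks: "ks = ks1 @ ks2 @ ks3"
    and l: "list_all2 (\<lambda>k v. v \<in> weight_space k) ks1 xs"
      "list_all2 (\<lambda>k v. v \<in> weight_space k) ks2 ys"
      "list_all2 (\<lambda>k v. v \<in> weight_space k) ks3 zs"
    by (auto simp: splits_def list_all2_append2)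
  have "g ys \<in> weight_space (sum_list ks2 + w)"
    using g l(2) by (auto simp: has_weight_def)
  then have "list_all2 (\<lambda>k v. v \<in> weight_space k) (ks1 @ (sum_list ks2 + w) # ks3) (xs @ g ys # zs)"
    using l(1,3) by (auto intro: list_all2_appendI)
  then have "f (xs @ g ys # zs) \<in> weight_space (sum_list (ks1 @ (sum_list ks2 + w) # ks3) + v)"
    using f unfolding has_weight_def by blast
  then show "f (xs @ g ys # zs) \<in> weight_space (sum_list ks + (v + w))"
    by (simp add: ks algebra_simps)
qed

lemma has_weight_alt: "has_weight w f \<Longrightarrow> has_weight w (alt e f)"
  by (simp add: has_weight_def alt_apply weight_space_alt)

lemma has_weight_add: "has_weight w f \<Longrightarrow> has_weight w g \<Longrightarrow> has_weight w (f + g)"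
  by (simp add: has_weight_def weight_space_add)

lemma has_weight_uminus: "has_weight w f \<Longrightarrow> has_weight w (- f)"
  using has_weight_alt[of w f 1] by (simp add: alt_def)

text \<open>Each letter is the sum of its parts in \<open>A\<close> and \<open>M\<close>; the
  induction moves letters from \<open>vs\<close> to a prefix that is already pure.\<close>

lemma multi_eq_0:
  fixes f :: "('a::ab_group_add \<times> 'a) list \<Rightarrow> 'a \<times> 'a"
  assumes f: "multi s f" and pure: "\<And>vs. \<forall>v\<in>set vs. fst v = 0 \<or> snd v = 0 \<Longrightarrow> f vs = 0"
  shows "f vs = 0"
proof -
  have "f (xs @ vs) = 0" if "\<forall>v\<in>set xs. fst v = 0 \<or> snd v = 0" for xs
    using that
  proof (induction vs arbitrary: xs)
    case Nil
    then show ?case using pure by simp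
  next
    case (Cons v vs)
    have "f (xs @ v # vs) = f (xs @ (fst v, 0) # vs) + f (xs @ (0, snd v) # vs)"
      using multi_add[OF f, of xs "(fst v, 0)" "(0, snd v)" vs] by simp
    also have "f (xs @ (fst v, 0) # vs) = 0"
      using Cons.IH[of "xs @ [(fst v, 0)]"] Cons.prems by auto
    also have "f (xs @ (0, snd v) # vs) = 0"
      using Cons.IH[of "xs @ [(0, snd v)]"] Cons.prems by auto
    finally show ?case by simp
  qed
  from this[of "[]"] show ?thesis by simp
qed

text \<open>The zero letter has every weight, so weights are not unique. Choosing 0 whenever the
  part in \<open>A\<close> vanishes makes the total count the letters outside \<open>M\<close>,
  which gives the last clause.\<close>

lemma pure_weights:
  assumes "\<forall>v\<in>set vs. fst v = 0 \<or> snd v = 0"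
  shows "\<exists>ks. list_all2 (\<lambda>k v. v \<in> weight_space k) ks vs \<and> sum_list ks \<ge> 0 \<and>
    (sum_list ks = 0 \<longrightarrow> (\<forall>v\<in>set vs. fst v = 0))"
  using assms
proof (induction vs)
  case (Cons v vs)
  then obtain ks where ks: "list_all2 (\<lambda>k v. v \<in> weight_space k) ks vs" "sum_list ks \<ge> 0"
    "sum_list ks = 0 \<longrightarrow> (\<forall>v\<in>set vs. fst v = 0)" by auto
  show ?case
  proof (cases "fst v = 0")
    case True
    with ks show ?thesis by (intro exI[of _ "0 # ks"]) (auto simp: weight_space_def)
  next
    case False
    with ks Cons.prems show ?thesis by (intro exI[of _ "1 # ks"]) (auto simp: weight_space_def)
  qed
qed simp

section \<open>The weighted Lie algebra of \<open>A \<oplus> M\<close>\<close>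

context assoc_algebra
begin

definition vscale :: "'k \<Rightarrow> 'a \<times> 'a \<Rightarrow> 'a \<times> 'a" where
  "vscale c v = (scale c (fst v), scale c (snd v))"

sublocale V: vector_space vscale
  by unfold_locales (simp_all add: vscale_def prod_eq_iff scale_right_distrib scale_left_distrib)

definition G :: "int \<Rightarrow> int \<Rightarrow> (('a \<times> 'a) list \<Rightarrow> 'a \<times> 'a) set" where
  "G d w = {f \<in> maps vscale d. has_weight w f}"

lemma G_maps: "f \<in> G d w \<Longrightarrow> f \<in> maps vscale d"
  by (simp add: G_def)

text \<open>On pure letters the total weight is nonnegative, so the value has weight at least 2,
  where \<open>weight_space\<close> is zero.\<close>

lemma G_top:
  assumes "f \<in> G d 2" shows "f = 0"
proof
  fix vs
  show "f vs = 0 vs"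
  proof (simp, rule multi_eq_0)
    show "multi vscale f" using assms by (simp add: G_def maps_def)
    fix us :: "('a \<times> 'a) list" assume "\<forall>v\<in>set us. fst v = 0 \<or> snd v = 0"
    from pure_weights[OF this] obtain ks where
      ks: "list_all2 (\<lambda>k v. v \<in> weight_space k) ks us" "sum_list ks \<ge> 0" by blast
    have "f us \<in> weight_space (sum_list ks + 2)"
      using assms ks(1) by (simp add: G_def has_weight_def)
    then show "f us = 0" using ks(2) by (simp add: weight_space_def prod_eq_iff)
  qed
qed

sublocale weighted_lie G brk
proof
  fix d w show "0 \<in> G d w"
    by (simp add: G_def V.maps_zero has_weight_def)
next
  fix f g :: "('a \<times> 'a) list \<Rightarrow> 'a \<times> 'a" and d w
  assume "f \<in> G d w" "g \<in> G d w" then show "f + g \<in> G d w"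
    by (simp add: G_def V.maps_add has_weight_add)
next
  fix f d w assume "f \<in> G d w" then show "- f \<in> G d w"
    by (simp add: G_def V.maps_uminus has_weight_uminus)
next
  fix f g d e v w assume fg: "f \<in> G d v" "g \<in> G e w"
  have "has_weight (v + w) (cmp f g + - alt (d * e) (cmp g f))"
    using fg has_weight_cmp[of v f w g] has_weight_cmp[of w g v f]
    by (intro has_weight_add has_weight_uminus has_weight_alt) (auto simp: G_def add.commute)
  then show "brk f g \<in> G (d + e) (v + w)"
    using fg V.brk_closed[OF fg[THEN G_maps]] brk_eq[OF fg[THEN G_maps]] by (simp add: G_def)
next
  fix f f' g d e v w assume "f \<in> G d v" "f' \<in> G d v" "g \<in> G e w"
  from this[THEN G_maps] show "brk (f + f') g = brk f g + brk f' g" by (rule V.brk_add_left)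
next
  fix f g d e v w assume "f \<in> G d v" "g \<in> G e w"
  note fg = this[THEN G_maps]
  show "brk f g = - alt (d * e) (brk g f)"
    unfolding brk_eq[OF fg] brk_eq[OF fg(2,1)] by (auto simp: alt_def)
next
  fix f g h d e k u v w assume "f \<in> G d u" "g \<in> G e v" "h \<in> G k w"
  from this[THEN G_maps] show "brk (brk f g) h = brk f (brk g h) + alt (e * k) (brk (brk f h) g)"
    by (rule V.brk_jacobi)
next
  fix f d assume "f \<in> G d 2" then show "f = 0" by (rule G_top)
next
  fix f :: "('a \<times> 'a) list \<Rightarrow> 'a \<times> 'a" assume f: "f + f = 0"
  have "f vs = 0" for vs
  proof -
    have "vscale 2 (f vs) = f vs + f vs"
      using V.scale_left_distrib[of 1 1 "f vs"] by simp
    also have "\<dots> = 0" using fun_cong[OF f, of vs] by simp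
    finally show ?thesis by simp
  qed
  then show "f = 0" by (simp add: fun_eq_iff)
qed

end

section \<open>The brackets as derived brackets\<close>

text \<open>Maps such as \<open>semidirect\<close> are meaningful only on lists of their own arity,
  so \<open>f\<close> and \<open>g\<close> are compared with honest multilinear maps on those lists
  only. Position \<open>i\<close> corresponds to the factorization with
  \<open>length xs = i - 1\<close> and \<open>length ys = n\<close>.\<close>

lemma gerstenhaber_comp_eq:
  assumes len: "length vs + 1 = m + n"
    and f: "multi s f'" "\<And>us. length us = m \<Longrightarrow> f us = f' us"
    and g: "g' \<in> maps s (int n - 1)" "\<And>us. length us = n \<Longrightarrow> g us = g' us"
  shows "gerstenhaber_comp m f n g vs = cmp f' g' vs"
proof -
  let ?S = "{(xs, ys, zs) \<in> splits vs. length ys = n}"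
  have zero: "f' (xs @ g' ys # zs) = 0" if "length ys \<noteq> n" for xs ys zs
    using maps_len[OF g(1), of ys] that multi_0[OF f(1)] by simp
  have "cmp f' g' vs = (\<Sum>(xs, ys, zs)\<in>?S.
      alt (int (length xs) * (int (length ys) - 1)) (f' (xs @ g' ys # zs)))"
    unfolding cmp_def
    by (rule sum.mono_neutral_right) (auto, metis zero alt_0)
  also have "\<dots> = (\<Sum>i = 1..m. alt ((int i - 1) * (int n - 1)) (insert_at i f n g vs))"
  proof (rule sum.reindex_bij_witness[of _
        "\<lambda>i. (take (i - 1) vs, take n (drop (i - 1) vs), drop (i - 1 + n) vs)"
        "\<lambda>(xs, ys, zs). length xs + 1"], goal_cases)
    case (4 i)
    have "take (i - 1) vs @ take n (drop (i - 1) vs) @ drop (i - 1 + n) vs = vs"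
      by (metis append_take_drop_id add.commute drop_drop)
    then show ?case using 4 len by (auto simp: splits_def)
  next
    case (5 a)
    then obtain xs ys zs where a: "a = (xs, ys, zs)" "vs = xs @ ys @ zs" "length ys = n"
      by (auto simp: splits_def)
    then have "length (xs @ g ys # zs) = m" using len by simp
    then show ?case using a f(2) g(2) by (simp add: insert_at_def)
  qed (use len in \<open>auto simp: splits_def\<close>)
  finally show ?thesis by (simp add: gerstenhaber_comp_def)
qed

lemma gerstenhaber_eq:
  assumes len: "length vs + 1 = m + n"
    and f: "f' \<in> maps s (int m - 1)" "\<And>us. length us = m \<Longrightarrow> f us = f' us"
    and g: "g' \<in> maps s (int n - 1)" "\<And>us. length us = n \<Longrightarrow> g us = g' us"
  shows "gerstenhaber m f n g vs = brk f' g' vs"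
  unfolding gerstenhaber_def brk_eq[OF f(1) g(1)]
    gerstenhaber_comp_eq[OF len maps_multi[OF f(1)] f(2) g, simplified]
    gerstenhaber_comp_eq[OF len[unfolded add.commute[of m]] maps_multi[OF g(1)] g(2) f, simplified]
  by (simp add: alt_apply)

section \<open>Cochains as the maps of weight 1\<close>

context assoc_algebra
begin

text \<open>Cochains are graded by arity, \<open>maps\<close> by arity minus one; this is the shift
  behind the signs of the derived brackets.\<close>

lemma cochain_grading_eq_maps: "cochain_grading scale d = maps scale (d - 1)"
proof (cases "d < 0")
  case True
  have "P = 0" if "P \<in> maps scale (d - 1)" for P
    using True maps_len[OF that] by (auto simp: fun_eq_iff)
  then show ?thesis using True maps_zero by (auto simp: cochain_grading_def)
next
  case False
  have "multilinear_on scale UNIV scale (nat d) P \<longleftrightarrow> multi scale P"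
    if P: "\<And>xs. length xs \<noteq> nat d \<Longrightarrow> P xs = 0" for P
  proof
    assume m: "multilinear_on scale UNIV scale (nat d) P"
    show "multi scale P"
      unfolding multi_def
    proof (intro allI)
      fix xs y z zs c
      show "P (xs @ (y + z) # zs) = P (xs @ y # zs) + P (xs @ z # zs) \<and>
          P (xs @ scale c y # zs) = scale c (P (xs @ y # zs))"
        using m[unfolded multilinear_on_def, rule_format, of "xs @ y # zs" "length xs" y z c]
          P[of "xs @ _ # zs"]
        by (cases "length (xs @ y # zs) = nat d") auto
    qed
  next
    assume "multi scale P"
    then show "multilinear_on scale UNIV scale (nat d) P"
      by (auto simp: multilinear_on_def upd_conv_take_nth_drop multi_def)
  qed
  moreover have "length xs \<noteq> nat d \<longleftrightarrow> int (length xs) \<noteq> d - 1 + 1" for xs :: "'a list"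
    using False by auto
  ultimately show ?thesis
    using False unfolding cochain_grading_def cochains_def maps_def by auto
qed

text \<open>If all letters have weight 0, the value lies in \<open>A\<close> and has weight 1. A
  letter of nonzero weight has no part in \<open>M\<close>, so \<open>P\<close> vanishes, and 0 has
  every weight.\<close>

lemma extend_G:
  assumes P: "P \<in> maps scale d"
  shows "extend P \<in> G d 1"
proof -
  note m = maps_multi[OF P]
  have "extend P \<in> maps vscale d"
    using maps_len[OF P]
    by (auto simp: maps_def multi_def extend_def vscale_def zero_prod_def multi_add[OF m] multi_scale[OF m])
  moreover have "extend P vs \<in> weight_space (sum_list ks + 1)"
    if "list_all2 (\<lambda>k v. v \<in> weight_space k) ks vs" for ks :: "int list" and vs :: "('a \<times> 'a) list"
  proof (cases "\<forall>k\<in>set ks. k = 0")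
    case True
    then have "sum_list ks = 0" by (induction ks) auto
    then show ?thesis by (simp add: weight_space_def extend_def)
  next
    case False
    then obtain i where i: "i < length ks" "ks ! i \<noteq> 0" by (auto simp: in_set_conv_nth)
    with that have "snd (vs ! i) = 0" "i < length vs"
      by (auto simp: list_all2_conv_all_nth weight_space_def)
    then have "map snd vs = take i (map snd vs) @ 0 # drop (Suc i) (map snd vs)"
      by (metis id_take_nth_drop length_map nth_map)
    then have "P (map snd vs) = 0" by (metis multi_0[OF m])
    then show ?thesis by (simp add: weight_space_def extend_def)
  qed
  ultimately show ?thesis by (simp add: G_def has_weight_def)
qed

text \<open>The evaluation on \<open>M\<close> and projection to \<open>A\<close> by which
  \<open>binary_bracket\<close> reads off its result; on maps of weight 1 it is inverse to
  \<open>extend\<close>.\<close>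

definition restrict_M :: "(('a \<times> 'a) list \<Rightarrow> 'a \<times> 'a) \<Rightarrow> 'a list \<Rightarrow> 'a" where
  "restrict_M f us = fst (f (map (Pair 0) us))"

lemma restrict_extend [simp]: "restrict_M (extend P) = P"
  by (simp add: restrict_M_def extend_def fun_eq_iff comp_def)

lemma extend_eq_iff: "extend P = extend Q \<longleftrightarrow> P = Q" for P Q :: "'a list \<Rightarrow> 'a"
  by (metis restrict_extend)

lemma extend_zero [simp]: "extend 0 = 0"
  and extend_add: "extend (P + Q) = extend P + extend Q"
  and extend_alt: "extend (alt e P) = alt e (extend P)"
  and extend_diff: "extend (P - Q) = extend P - extend Q"
  and extend_scale: "extend (\<lambda>us. scale c (P us)) = (\<lambda>vs. vscale c (extend P vs))"
  by (auto simp: extend_def fun_eq_iff vscale_def alt_def prod_eq_iff)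

lemma restrict_add: "restrict_M (f + g) = restrict_M f + restrict_M g"
  and restrict_scale: "restrict_M (\<lambda>vs. vscale c (f vs)) = (\<lambda>us. scale c (restrict_M f us))"
  by (auto simp: restrict_M_def fun_eq_iff vscale_def alt_def)

lemma restrict_maps:
  assumes "f \<in> G d w" shows "restrict_M f \<in> maps scale d"
proof -
  note f = G_maps[OF assms]
  note m = maps_multi[OF f]
  have "multi scale (restrict_M f)"
    using multi_add[OF m, of _ "(0, _)" "(0, _)"] multi_scale[OF m, of _ _ "(0, _)"]
    by (simp add: multi_def restrict_M_def vscale_def)
  then show ?thesis using maps_len[OF f] by (simp add: maps_def restrict_M_def)
qed

text \<open>On pure letters of positive total weight, a map of weight 1 takes a value of weight at
  least 2, hence 0. What remains is its restriction to \<open>M\<close>, with values in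
  \<open>A\<close>.\<close>

lemma extend_restrict:
  assumes f: "f \<in> G d 1" shows "extend (restrict_M f) = f"
proof
  fix vs
  have r: "extend (restrict_M f) \<in> G d 1" by (rule extend_G[OF restrict_maps[OF f]])
  have "(extend (restrict_M f) - f) vs = 0"
  proof (rule multi_eq_0)
    show "multi vscale (extend (restrict_M f) - f)"
      using V.maps_diff[OF G_maps[OF r] G_maps[OF f]] by (rule maps_multi)
    fix us :: "('a \<times> 'a) list" assume pure: "\<forall>v\<in>set us. fst v = 0 \<or> snd v = 0"
    from pure_weights[OF pure] obtain ks where
      ks: "list_all2 (\<lambda>k v. v \<in> weight_space k) ks us" "sum_list ks \<ge> 0"
        "sum_list ks = 0 \<longrightarrow> (\<forall>v\<in>set us. fst v = 0)" by blast
    have w: "extend (restrict_M f) us \<in> weight_space (sum_list ks + 1)"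
      "f us \<in> weight_space (sum_list ks + 1)"
      using f r ks(1) by (simp_all add: G_def has_weight_def)
    show "(extend (restrict_M f) - f) us = 0"
    proof (cases "sum_list ks = 0")
      case True
      then have "map (Pair 0) (map snd us) = us"
        using ks(3) by (auto intro!: map_idI simp: prod_eq_iff)
      then show ?thesis using w True
        by (simp add: extend_def restrict_M_def weight_space_def prod_eq_iff)
    next
      case False
      then show ?thesis using w ks(2) by (simp add: weight_space_def prod_eq_iff)
    qed
  qed
  then show "extend (restrict_M f) vs = f vs" by simp
qed

text \<open>\<open>semidirect\<close> reads the first two letters of a list of any length; the
  cut-off makes it homogeneous of degree 1.\<close>

definition \<Theta> :: "('a \<times> 'a) list \<Rightarrow> 'a \<times> 'a" where
  "\<Theta> vs = (if length vs = 2 then semidirect vs else 0)"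

definition H :: "('a \<times> 'a) list \<Rightarrow> 'a \<times> 'a" where
  "H vs = (if length vs = 2 then (0, neg_mult (fst (vs ! 0)) (fst (vs ! 1))) else 0)"

lemma length_2: "length vs = 2 \<longleftrightarrow> (\<exists>x y. vs = [x, y])"
  by (auto simp: length_Suc_conv eval_nat_numeral)

lemma append_Cons_length_2:
  "length (xs @ y # zs) = 2 \<longleftrightarrow> (\<exists>z. xs = [] \<and> zs = [z]) \<or> (\<exists>x. xs = [x] \<and> zs = [])"
  by (cases xs) (auto simp: length_Suc_conv)

lemma bilinear_maps:
  assumes "\<And>x y z c. \<beta> (x + y) z = \<beta> x z + \<beta> y z \<and> \<beta> z (x + y) = \<beta> z x + \<beta> z y \<and>
    \<beta> (vscale c x) z = vscale c (\<beta> x z) \<and> \<beta> z (vscale c x) = vscale c (\<beta> z x)"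
  shows "(\<lambda>vs. if length vs = 2 then \<beta> (vs ! 0) (vs ! 1) else 0) \<in> maps vscale 1"
proof -
  let ?f = "\<lambda>vs. if length vs = 2 then \<beta> (vs ! 0) (vs ! 1) else 0"
  have "?f (xs @ (y + z) # zs) = ?f (xs @ y # zs) + ?f (xs @ z # zs) \<and>
      ?f (xs @ vscale c y # zs) = vscale c (?f (xs @ y # zs))" for xs y z zs c
  proof (cases "length (xs @ y # zs) = 2")
    case True
    then show ?thesis
      unfolding append_Cons_length_2 by (elim disjE exE conjE) (simp_all add: assms)
  next
    case False
    then show ?thesis by simp
  qed
  then have "multi vscale ?f" unfolding multi_def by blast
  then show ?thesis by (simp add: maps_def)
qed

lemma \<Theta>_alt_def: "\<Theta> = (\<lambda>vs. if length vs = 2 then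
    (\<lambda>u v. (fst u * fst v, fst u * snd v + snd u * fst v)) (vs ! 0) (vs ! 1) else 0)"
  by (auto simp: \<Theta>_def semidirect_def case_prod_unfold)

lemma H_alt_def: "H = (\<lambda>vs. if length vs = 2 then
    (\<lambda>u v. (0, - (fst u * fst v))) (vs ! 0) (vs ! 1) else 0)"
  by (auto simp: H_def neg_mult_def)

lemma \<Theta>_G: "\<Theta> \<in> G 1 (- 1)"
proof -
  have "\<Theta> \<in> maps vscale 1"
    unfolding \<Theta>_alt_def
    by (rule bilinear_maps)
       (simp add: vscale_def algebra_simps scale_mult_left scale_mult_right scale_right_distrib)
  moreover have "has_weight (- 1) \<Theta>"
    by (auto simp: has_weight_def \<Theta>_alt_def length_2 list_all2_Cons2 weight_space_def)
  ultimately show ?thesis by (simp add: G_def)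
qed

lemma H_G: "H \<in> G 1 (- 2)"
proof -
  have "H \<in> maps vscale 1"
    unfolding H_alt_def
    by (rule bilinear_maps)
       (simp add: vscale_def algebra_simps scale_mult_left scale_mult_right)
  moreover have "has_weight (- 2) H"
    by (auto simp: has_weight_def H_alt_def length_2 list_all2_Cons2 weight_space_def)
  ultimately show ?thesis by (simp add: G_def)
qed

lemma cmp_bilinear:
  assumes "f \<in> maps vscale 1" "g \<in> maps vscale 1"
  shows "cmp f g [x, y, z] = f [g [x, y], z] - f [x, g [y, z]]"
  using gerstenhaber_comp_eq[of "[x, y, z]" 2 2 vscale f f g g] assms maps_multi[OF assms(1)]
  by (simp add: gerstenhaber_comp_def insert_at_def numeral_2_eq_2 alt_def)

lemma maps_2_eqI:
  assumes "f \<in> maps vscale 2" "\<And>x y z. f [x, y, z] = 0"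
  shows "f = 0"
proof
  fix vs show "f vs = 0 vs"
  proof (cases "length vs = 3")
    case True
    then show ?thesis using assms(2) by (auto simp: length_Suc_conv eval_nat_numeral)
  next
    case False
    then show ?thesis using maps_len[OF assms(1), of vs] by simp
  qed
qed

text \<open>The three equations are associativity of the semidirect product, the Hochschild cocycle
  condition for \<open>- \<mu>\<close>, and the fact that H has values in \<open>M\<close> but sees
  only the parts of its arguments in \<open>A\<close>.\<close>

sublocale derived_brackets G brk \<Theta> H
proof
  note T = G_maps[OF \<Theta>_G] and N = G_maps[OF H_G]
  show "\<Theta> \<in> G 1 (- 1)" "H \<in> G 1 (- 2)" by (rule \<Theta>_G H_G)+
  have c: "brk f g \<in> maps vscale 2" if "f \<in> maps vscale 1" "g \<in> maps vscale 1" for f g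
    using V.brk_closed[OF that] by simp
  show "brk \<Theta> \<Theta> = 0"
    by (rule maps_2_eqI[OF c[OF T T]])
       (simp add: brk_eq[OF T T] alt_apply cmp_bilinear[OF T T], simp add: \<Theta>_alt_def algebra_simps)
  show "brk \<Theta> H = 0"
    by (rule maps_2_eqI[OF c[OF T N]])
       (simp add: brk_eq[OF T N] alt_apply cmp_bilinear[OF T N] cmp_bilinear[OF N T],
        simp add: \<Theta>_alt_def H_alt_def alt_def algebra_simps)
  show "brk H H = 0"
    by (rule maps_2_eqI[OF c[OF N N]])
       (simp add: brk_eq[OF N N] alt_apply cmp_bilinear[OF N N], simp add: H_alt_def)
qed

lemma binary_bracket_eq:
  assumes P: "P \<in> maps scale (int p - 1)" and Q: "Q \<in> maps scale (int q - 1)"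
  shows "binary_bracket p q P Q = restrict_M (m2 (int p) (extend P) (extend Q))"
proof
  fix us
  note eP = G_maps[OF extend_G[OF P]] and eQ = G_maps[OF extend_G[OF Q]]
  have 1: "gerstenhaber 2 semidirect p (extend P) vs = brk \<Theta> (extend P) vs" if "length vs = p + 1" for vs
    by (rule gerstenhaber_eq[of _ _ _ _ vscale])
       (use that eP G_maps[OF \<Theta>_G] in \<open>simp_all add: \<Theta>_def\<close>)
  have B: "brk \<Theta> (extend P) \<in> maps vscale (int (p + 1) - 1)"
    using V.brk_closed[OF G_maps[OF \<Theta>_G] eP] by simp
  note BB = V.brk_closed[OF B eQ]
  show "binary_bracket p q P Q us = restrict_M (m2 (int p) (extend P) (extend Q)) us"
  proof (cases "length us = p + q")
    case True
    then have "gerstenhaber (p + 1) (gerstenhaber 2 semidirect p (extend P)) q (extend Q)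
        (map (Pair 0) us) = brk (brk \<Theta> (extend P)) (extend Q) (map (Pair 0) us)"
      by (intro gerstenhaber_eq[OF _ B _ eQ]) (simp_all add: 1)
    then show ?thesis using True
      by (simp add: binary_bracket_def restrict_M_def m2_def alt_apply alt_def)
  next
    case False
    then show ?thesis using maps_len[OF BB, of "map (Pair 0) us"]
      by (auto simp: binary_bracket_def restrict_M_def m2_def alt_apply alt_def)
  qed
qed

section \<open>The ternary bracket as a derived bracket\<close>

lemma sum_single:
  assumes "finite A" "a \<in> A" "\<And>x. x \<in> A \<Longrightarrow> x \<noteq> a \<Longrightarrow> f x = 0"
  shows "sum f A = f a"
  using assms sum.mono_neutral_right[of A "{a}" f] by auto

lemma extend_kills: "P \<in> maps scale d \<Longrightarrow> snd v = 0 \<Longrightarrow> extend P (xs @ v # zs) = 0"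
  using multi_0[OF maps_multi, of P scale d "map snd xs" "map snd zs"]
  by (simp add: extend_def prod_eq_iff)

lemma cmp_extend_0:
  assumes "P \<in> maps scale d" "\<And>vs. snd (f vs) = 0"
  shows "cmp (extend P) f = 0"
  by (auto simp: cmp_def fun_eq_iff extend_kills[OF assms(1)] assms(2))

lemma snd_cmp_extend: "snd (cmp (extend P) f vs) = 0"
  by (auto simp: cmp_def extend_def snd_sum alt_def intro!: sum.neutral)

lemma fst_cmp_H: "(\<And>vs. fst (f vs) = 0) \<Longrightarrow> fst (cmp f g vs) = 0"
  by (auto simp: cmp_def fst_sum alt_def intro!: sum.neutral)

text \<open>All correction terms of the pre-Lie identity vanish: \<open>extend P\<close> is zero on letters in
  \<open>A\<close>, and \<open>extend Q\<close> has values in \<open>A\<close>.\<close>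

lemma cmp_cmp_extend:
  assumes P: "P \<in> maps scale d" and Q: "Q \<in> maps scale e" and f: "f \<in> maps vscale k"
  shows "cmp (cmp (extend P) f) (extend Q) = cmp (extend P) (cmp f (extend Q))"
  using pre_Lie[OF maps_multi[OF G_maps[OF extend_G[OF P]]] f G_maps[OF extend_G[OF Q]]]
  by (simp add: cmp_extend_0[OF P] snd_cmp_extend extend_def cmp_0_left)

text \<open>\<open>extend R\<close> cannot be inserted into \<open>extend Q\<close>, so by
  \<open>cmp_cmp\<close> the two stand side by side and fill both slots of H, in either order. The
  second exponent is \<open>(q - 1) * (r - 1)\<close> from the exchange plus
  \<open>r * (q - 1)\<close> from \<open>beside\<close>.\<close>

lemma cmp_H_extend:
  assumes Q: "Q \<in> maps scale (int q - 1)" and R: "R \<in> maps scale (int r - 1)"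
    and len: "length us = q + r"
  shows "snd (cmp (cmp H (extend Q)) (extend R) (map (Pair 0) us)) =
    alt (int q * (int r - 1)) (neg_mult (Q (take q us)) (R (drop q us))) +
    alt ((int q - 1) * (2 * int r - 1)) (neg_mult (R (take r us)) (Q (drop r us)))"
proof -
  have beside: "snd (beside H (extend P) (extend S) (map (Pair 0) us)) =
      alt (int p * (int s - 1)) (neg_mult (P (take p us)) (S (drop p us)))"
    if P: "P \<in> maps scale (int p - 1)" and S: "S \<in> maps scale (int s - 1)"
      and ps: "length us = p + s" for P S p s
  proof -
    let ?vs = "map (Pair 0) us"
    let ?\<phi> = "\<lambda>xs ys ts ws zs. alt (int (length xs) * (int (length ys) - 1) +
        int (length xs + length ys + length ts) * (int (length ws) - 1))
      (H (xs @ extend P ys # ts @ extend S ws # zs))"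
    \<comment> \<open>Since \<open>p + s\<close> letters are already consumed by the two maps, every
      other piece of a contributing factorization is empty.\<close>
    have zero: "?\<phi> xs ys ts ws zs = 0" if "xs @ ys @ ts @ ws @ zs = ?vs" "(xs, ys) \<noteq> ([], take p ?vs)
        \<or> (ts, ws, zs) \<noteq> ([], drop p ?vs, [])" for xs ys ts ws zs
    proof (cases "length ys = p \<and> length ws = s")
      case False
      then have "extend P ys = 0 \<or> extend S ws = 0"
        using maps_len[OF P] maps_len[OF S] by (auto simp: extend_def zero_prod_def)
      then show ?thesis by (auto simp: H_alt_def nth_Cons' nth_append simp flip: zero_prod_def)
    next
      case True
      then have "length xs + length ts + length zs = 0"
        using arg_cong[OF that(1), of length] ps by simp
      then have "xs = [] \<and> ts = [] \<and> zs = []" by simp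
      moreover have "ys = take p ?vs" "ws = drop p ?vs"
        using calculation True that(1)[symmetric] by simp_all
      ultimately show ?thesis using that(2) by simp
    qed
    have "beside H (extend P) (extend S) ?vs =
        (\<Sum>(ts, ws, zs)\<in>splits (drop p ?vs). ?\<phi> [] (take p ?vs) ts ws zs)"
    proof -
      have "(\<Sum>(ts, ws, zs)\<in>splits us'. ?\<phi> xs ys ts ws zs) = 0"
        if "(xs, ys, us') \<in> splits ?vs" "(xs, ys, us') \<noteq> ([], take p ?vs, drop p ?vs)" for xs ys us'
      proof (rule sum.neutral, rule ballI, unfold split_paired_all split_conv)
        fix ts ws zs assume "(ts, ws, zs) \<in> splits us'"
        then have us': "ts @ ws @ zs = us'" by (simp add: splits_def)
        then have "xs @ ys @ ts @ ws @ zs = ?vs" using that(1) by (simp add: splits_def)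
        moreover have "us' = drop p ?vs" if "ys = take p ?vs" "xs = []"
          using calculation us' that by (metis append_take_drop_id append_Nil same_append_eq)
        then have "(xs, ys) \<noteq> ([], take p ?vs)" using that(2) by auto
        ultimately show "?\<phi> xs ys ts ws zs = 0" by (intro zero) auto
      qed
      then show ?thesis
        unfolding beside_def
        by (intro trans[OF sum_single[OF finite_splits, of "([], take p ?vs, drop p ?vs)"]])
           (unfold split_paired_all split_conv, simp_all add: splits_def)
    qed
    also have "\<dots> = ?\<phi> [] (take p ?vs) [] (drop p ?vs) []"
    proof -
      have "?\<phi> [] (take p ?vs) ts ws zs = 0" if "(ts, ws, zs) \<in> splits (drop p ?vs)"
        "(ts, ws, zs) \<noteq> ([], drop p ?vs, [])" for ts ws zs
        by (rule zero) (use that in \<open>simp_all add: splits_def\<close>)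
      then show ?thesis
        by (intro trans[OF sum_single[OF finite_splits, of "([], drop p ?vs, [])"]])
           (unfold split_paired_all split_conv, simp_all add: splits_def)
    qed
    finally show ?thesis
      using ps by (simp add: H_def extend_def take_map drop_map comp_def alt_def)
  qed
  have e: "extend Q \<in> G (int q - 1) 1" "extend R \<in> G (int r - 1) 1"
    using Q R by (simp_all add: extend_G)
  have "cmp (extend Q) (extend R) = 0" using cmp_extend_0[OF Q] by (simp add: extend_def)
  then show ?thesis
    using cmp_cmp[OF maps_multi[OF G_maps[OF H_G]] e[THEN G_maps]] beside[OF Q R len]
      beside[OF R Q] len
    by (simp add: cmp_0_right[OF maps_multi[OF G_maps[OF H_G]]] alt_def)
qed

lemma fst_alt: "fst (alt e v) = alt e (fst v)"
  by (simp add: alt_def)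

text \<open>\<open>extend P\<close> sees only the part in \<open>M\<close> of the inserted value,
  which \<open>cmp_H_extend\<close> gives as two terms; each of them yields one
  \<open>nested\<close> sum.\<close>

lemma nested_eq:
  assumes P: "P \<in> maps scale (int p - 1)" and Q: "Q \<in> maps scale (int q - 1)"
    and R: "R \<in> maps scale (int r - 1)" and len: "length us + 1 = p + q + r"
  shows "fst (cmp (extend P) (cmp (cmp H (extend Q)) (extend R)) (map (Pair 0) us)) =
    alt (int p + int q - 1) (nested p q r P Q R us) +
    alt (int p + int q + int q * int r) (nested p r q P R Q us)"
proof -
  define K where "K = cmp (cmp H (extend Q)) (extend R)"
  let ?vs = "map (Pair 0) us"
  note eP = G_maps[OF extend_G[OF P]] and eQ = G_maps[OF extend_G[OF Q]]
    and eR = G_maps[OF extend_G[OF R]] and mP = maps_multi[OF P]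
  have K: "K \<in> maps vscale (int (q + r) - 1)"
    using V.cmp_closed[OF V.cmp_closed[OF G_maps[OF H_G] eQ] eR] by (simp add: K_def algebra_simps)
  have "cmp (extend P) K ?vs = gerstenhaber_comp p (extend P) (q + r) K ?vs"
    using len maps_multi[OF eP] K by (intro gerstenhaber_comp_eq[symmetric]) auto
  then have "fst (cmp (extend P) K ?vs) = (\<Sum>i = 1..p. alt ((int i - 1) * (int q + int r - 1))
      (P (take (i - 1) us @ snd (K (map (Pair 0) (take (q + r) (drop (i - 1) us)))) #
        drop (i - 1 + (q + r)) us)))"
    by (simp add: gerstenhaber_comp_def fst_sum fst_alt insert_at_def extend_def take_map drop_map
        comp_def)
  also have "\<dots> = (\<Sum>i = 1..p. alt (int p + int q - 1)
      (alt (int p - 1 + int q * int r + (int i - 1) * (int q + int r - 1))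
        (P (take (i - 1) us
          @ neg_mult (Q (take q (drop (i - 1) us))) (R (take r (drop (i - 1 + q) us)))
          # drop (i - 1 + q + r) us))) +
      alt (int p + int q + int q * int r)
      (alt (int p - 1 + int r * int q + (int i - 1) * (int r + int q - 1))
        (P (take (i - 1) us
          @ neg_mult (R (take r (drop (i - 1) us))) (Q (take q (drop (i - 1 + r) us)))
          # drop (i - 1 + r + q) us))))"
  proof (rule sum.cong[OF refl])
    fix i assume i: "i \<in> {1..p}"
    have l: "length (take (q + r) (drop (i - 1) us)) = q + r"
      using i len by auto
    have td: "take q (take (q + r) xs) = take q xs" "take r (take (q + r) xs) = take r xs"
      "drop q (take (q + r) xs) = take r (drop q xs)" "drop r (take (q + r) xs) = take q (drop r xs)"
      for xs :: "'a list"
      by (simp_all add: drop_take)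
    show "alt ((int i - 1) * (int q + int r - 1))
        (P (take (i - 1) us @ snd (K (map (Pair 0) (take (q + r) (drop (i - 1) us)))) #
          drop (i - 1 + (q + r)) us)) = alt (int p + int q - 1)
      (alt (int p - 1 + int q * int r + (int i - 1) * (int q + int r - 1))
        (P (take (i - 1) us
          @ neg_mult (Q (take q (drop (i - 1) us))) (R (take r (drop (i - 1 + q) us)))
          # drop (i - 1 + q + r) us))) +
      alt (int p + int q + int q * int r)
      (alt (int p - 1 + int r * int q + (int i - 1) * (int r + int q - 1))
        (P (take (i - 1) us
          @ neg_mult (R (take r (drop (i - 1) us))) (Q (take q (drop (i - 1 + r) us)))
          # drop (i - 1 + r + q) us)))"
      unfolding K_def cmp_H_extend[OF Q R l] multi_add[OF mP] multi_alt[OF mP] td drop_drop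
      by (simp only: alt_add alt_alt add_ac)
         (intro arg_cong2[of _ _ _ _ "(+)"] alt_cong; auto)
  qed
  also have "\<dots> = alt (int p + int q - 1) (nested p q r P Q R us) +
      alt (int p + int q + int q * int r) (nested p r q P R Q us)"
    unfolding nested_def sum.distrib alt_sum[symmetric] ..
  finally show ?thesis by (simp add: K_def)
qed

text \<open>Whenever a composite that begins with an extended cochain is inserted into another
  extended cochain, the result is zero, as its values lie in \<open>A\<close>. The composite that
  begins with H has values in \<open>M\<close>, so its part in \<open>A\<close> is zero; three terms
  are left.\<close>

lemma fst_derived_ternary:
  assumes P: "P \<in> maps scale a" and Q: "Q \<in> maps scale b" and R: "R \<in> maps scale c"
  shows "fst (brk (brk (brk H (extend P)) (extend Q)) (extend R) vs) =
    - alt a (fst (cmp (extend P) (cmp (cmp H (extend Q)) (extend R)) vs))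
    - alt ((1 + a) * b) (fst (cmp (extend Q) (cmp (cmp H (extend P)) (extend R)) vs))
    - alt ((1 + a + b) * c) (fst (cmp (extend R) (cmp (cmp H (extend P)) (extend Q)) vs))"
proof -
  note f = G_maps[OF extend_G[OF P]] and g = G_maps[OF extend_G[OF Q]]
    and h = G_maps[OF extend_G[OF R]] and H = G_maps[OF H_G]
  note Hf = V.cmp_closed[OF H f] and Hg = V.cmp_closed[OF H g]
  note Hf' = V.brk_closed[OF H f]
  note Hfg' = V.brk_closed[OF Hf' g]
  have B1: "brk H (extend P) = cmp H (extend P) - alt a (cmp (extend P) H)"
    using brk_eq[OF H f] by simp
  have B2: "brk (brk H (extend P)) (extend Q) = cmp (cmp H (extend P)) (extend Q) -
      alt a (cmp (extend P) (cmp H (extend Q))) -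
      alt ((1 + a) * b) (cmp (extend Q) (cmp H (extend P)))"
    unfolding brk_eq[OF Hf' g]
    unfolding B1 cmp_diff_left cmp_alt_left cmp_diff_right[OF maps_multi[OF g]]
      cmp_alt_right[OF maps_multi[OF g]] cmp_cmp_extend[OF P Q H]
    by (simp add: cmp_extend_0[OF Q] snd_cmp_extend)
  have B3: "brk (brk (brk H (extend P)) (extend Q)) (extend R) =
      cmp (cmp (cmp H (extend P)) (extend Q)) (extend R) -
      alt a (cmp (extend P) (cmp (cmp H (extend Q)) (extend R))) -
      alt ((1 + a) * b) (cmp (extend Q) (cmp (cmp H (extend P)) (extend R))) -
      alt ((1 + a + b) * c) (cmp (extend R) (cmp (cmp H (extend P)) (extend Q)))"
    unfolding brk_eq[OF Hfg' h]
    unfolding B2 cmp_diff_left cmp_alt_left cmp_diff_right[OF maps_multi[OF h]]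
      cmp_alt_right[OF maps_multi[OF h]] cmp_cmp_extend[OF P R Hg] cmp_cmp_extend[OF Q R Hf]
    by (simp add: cmp_extend_0[OF R] snd_cmp_extend)
  have "fst (cmp (cmp (cmp H (extend P)) (extend Q)) (extend R) vs) = 0"
    by (intro fst_cmp_H) (simp add: H_def)
  then show ?thesis by (simp add: B3 alt_apply fst_alt)
qed

text \<open>The three composites of \<open>fst_derived_ternary\<close>, two \<open>nested\<close>
  sums each by \<open>nested_eq\<close>, are the six sums of the definition.\<close>

lemma ternary_bracket_eq:
  assumes P: "P \<in> maps scale (int p - 1)" and Q: "Q \<in> maps scale (int q - 1)"
    and R: "R \<in> maps scale (int r - 1)"
  shows "ternary_bracket p q r P Q R = restrict_M (m3 (int q) (extend P) (extend Q) (extend R))"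
proof
  fix us
  note eP = G_maps[OF extend_G[OF P]] and eQ = G_maps[OF extend_G[OF Q]]
    and eR = G_maps[OF extend_G[OF R]]
  note B = V.brk_closed[OF V.brk_closed[OF V.brk_closed[OF G_maps[OF H_G] eP] eQ] eR]
  show "ternary_bracket p q r P Q R us =
      restrict_M (m3 (int q) (extend P) (extend Q) (extend R)) us"
  proof (cases "length us + 1 = p + q + r")
    case True
    have l: "length us + 1 = q + p + r" "length us + 1 = r + p + q" using True by auto
    show ?thesis
      unfolding restrict_M_def m3_def alt_apply fst_alt fst_derived_ternary[OF P Q R]
        nested_eq[OF P Q R True] nested_eq[OF Q P R l(1)] nested_eq[OF R P Q l(2)]
        ternary_bracket_def
      using True
      by (cases "even p"; cases "even q"; cases "even r"; simp add: alt_def)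
  next
    case False
    then show ?thesis
      using maps_len[OF B, of "map (Pair 0) us"]
      by (simp add: ternary_bracket_def restrict_M_def m3_def alt_apply alt_def)
  qed
qed

end

section \<open>The L-infinity structure\<close>

lemma permutations_2:
  assumes "distinct zs" "set zs = {..<2::nat}" shows "zs = [0, 1] \<or> zs = [1, 0]"
proof -
  have "length zs = 2" using distinct_card[OF assms(1)] assms(2) by simp
  then obtain a b where zs: "zs = [a, b]" by (auto simp: length_Suc_conv eval_nat_numeral)
  then have "a < 2" "b < 2" "a \<noteq> b" using assms by (auto simp: set_eq_iff)
  then show ?thesis using zs by (auto simp: less_2_cases_iff)
qed

lemma permutations_3:
  assumes "distinct zs" "set zs = {..<3::nat}"
  shows "zs = [0, 1, 2] \<or> zs = [1, 0, 2] \<or> zs = [0, 2, 1] \<or> zs = [1, 2, 0] \<or> zs = [2, 0, 1] \<or>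
    zs = [2, 1, 0]"
proof -
  have "length zs = 3" using distinct_card[OF assms(1)] assms(2) by simp
  then obtain a b c where zs: "zs = [a, b, c]" by (auto simp: length_Suc_conv eval_nat_numeral)
  have less_3: "k < 3 \<longleftrightarrow> k = 0 \<or> k = 1 \<or> k = 2" for k :: nat by auto
  have "a < 3" "b < 3" "c < 3" "a \<noteq> b" "a \<noteq> c" "b \<noteq> c"
    using assms by (auto simp: zs)
  then show ?thesis unfolding zs less_3 by auto
qed

context assoc_algebra
begin

section \<open>Linearity of the brackets in each argument\<close>

lemma extend_sum_list: "extend (\<Sum>z\<leftarrow>zs. f z) = (\<Sum>z\<leftarrow>zs. extend (f z))"
  for f :: "'c \<Rightarrow> 'a list \<Rightarrow> 'a"
  by (induction zs)
     (simp_all only: list.map sum_list.Nil sum_list.Cons extend_add extend_zero)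

lemma m2_add:
  assumes "x \<in> maps vscale a" "x' \<in> maps vscale a" "y \<in> maps vscale b" "y' \<in> maps vscale b"
  shows "m2 k (x + x') y = m2 k x y + m2 k x' y" "m2 k x (y + y') = m2 k x y + m2 k x y'"
  using assms G_maps[OF \<Theta>_G]
  by (simp_all add: m2_def V.brk_add_right[of _ 1 _ a] V.brk_add_left[of _ "1 + a" _ _ b]
      V.brk_add_right[of _ "1 + a" _ b] V.brk_closed alt_add)

lemma m2_scale:
  assumes "x \<in> maps vscale a" "y \<in> maps vscale b"
  shows "m2 k (\<lambda>vs. vscale c (x vs)) y = (\<lambda>vs. vscale c (m2 k x y vs))"
    "m2 k x (\<lambda>vs. vscale c (y vs)) = (\<lambda>vs. vscale c (m2 k x y vs))"
  using assms G_maps[OF \<Theta>_G]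
  by (simp_all add: m2_def V.brk_scale_right[of _ 1 _ a] V.brk_scale_left[of _ "1 + a" _ b]
      V.brk_scale_right[of _ "1 + a" _ b] V.brk_closed alt_apply V.scale_alt fun_eq_iff)

lemma m3_add:
  assumes "x \<in> maps vscale a" "x' \<in> maps vscale a" "y \<in> maps vscale b" "y' \<in> maps vscale b"
    "z \<in> maps vscale c" "z' \<in> maps vscale c"
  shows "m3 k (x + x') y z = m3 k x y z + m3 k x' y z" "m3 k x (y + y') z = m3 k x y z + m3 k x y' z"
    "m3 k x y (z + z') = m3 k x y z + m3 k x y z'"
  using assms G_maps[OF H_G]
  by (simp_all add: m3_def V.brk_add_right[of _ 1 _ a] V.brk_add_left[of _ "1 + a" _ _ b]
      V.brk_add_right[of _ "1 + a" _ b] V.brk_add_left[of _ "1 + a + b" _ _ c]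
      V.brk_add_right[of _ "1 + a + b" _ c] V.brk_closed alt_add)

lemma m3_scale:
  assumes "x \<in> maps vscale a" "y \<in> maps vscale b" "z \<in> maps vscale c"
  shows "m3 k (\<lambda>vs. vscale t (x vs)) y z = (\<lambda>vs. vscale t (m3 k x y z vs))"
    "m3 k x (\<lambda>vs. vscale t (y vs)) z = (\<lambda>vs. vscale t (m3 k x y z vs))"
    "m3 k x y (\<lambda>vs. vscale t (z vs)) = (\<lambda>vs. vscale t (m3 k x y z vs))"
  using assms G_maps[OF H_G]
  by (simp_all add: m3_def V.brk_scale_right[of _ 1 _ a] V.brk_scale_left[of _ "1 + a" _ b]
      V.brk_scale_right[of _ "1 + a" _ b] V.brk_scale_left[of _ "1 + a + b" _ c]
      V.brk_scale_right[of _ "1 + a + b" _ c] V.brk_closed alt_apply V.scale_alt fun_eq_iff)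

lemma binary_bracket_add:
  assumes "P \<in> maps scale (int p - 1)" "P' \<in> maps scale (int p - 1)"
    "Q \<in> maps scale (int q - 1)" "Q' \<in> maps scale (int q - 1)"
  shows "binary_bracket p q (P + P') Q = binary_bracket p q P Q + binary_bracket p q P' Q"
    "binary_bracket p q P (Q + Q') = binary_bracket p q P Q + binary_bracket p q P Q'"
  using m2_add[OF assms[THEN extend_G, THEN G_maps]] assms
  by (simp_all add: binary_bracket_eq maps_add extend_add restrict_add)

lemma binary_bracket_scale:
  assumes "P \<in> maps scale (int p - 1)" "Q \<in> maps scale (int q - 1)"
  shows "binary_bracket p q (\<lambda>us. scale c (P us)) Q = (\<lambda>us. scale c (binary_bracket p q P Q us))"
    "binary_bracket p q P (\<lambda>us. scale c (Q us)) = (\<lambda>us. scale c (binary_bracket p q P Q us))"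
  using m2_scale[OF assms[THEN extend_G, THEN G_maps]] assms
  by (simp_all add: binary_bracket_eq maps_scale extend_scale restrict_scale)

lemma ternary_bracket_add:
  assumes "P \<in> maps scale (int p - 1)" "P' \<in> maps scale (int p - 1)"
    "Q \<in> maps scale (int q - 1)" "Q' \<in> maps scale (int q - 1)"
    "R \<in> maps scale (int r - 1)" "R' \<in> maps scale (int r - 1)"
  shows "ternary_bracket p q r (P + P') Q R = ternary_bracket p q r P Q R + ternary_bracket p q r P' Q R"
    "ternary_bracket p q r P (Q + Q') R = ternary_bracket p q r P Q R + ternary_bracket p q r P Q' R"
    "ternary_bracket p q r P Q (R + R') = ternary_bracket p q r P Q R + ternary_bracket p q r P Q R'"
  using m3_add[OF assms[THEN extend_G, THEN G_maps]] assms
  by (simp_all add: ternary_bracket_eq maps_add extend_add restrict_add)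

lemma ternary_bracket_scale:
  assumes "P \<in> maps scale (int p - 1)" "Q \<in> maps scale (int q - 1)" "R \<in> maps scale (int r - 1)"
  shows "ternary_bracket p q r (\<lambda>us. scale c (P us)) Q R = (\<lambda>us. scale c (ternary_bracket p q r P Q R us))"
    "ternary_bracket p q r P (\<lambda>us. scale c (Q us)) R = (\<lambda>us. scale c (ternary_bracket p q r P Q R us))"
    "ternary_bracket p q r P Q (\<lambda>us. scale c (R us)) = (\<lambda>us. scale c (ternary_bracket p q r P Q R us))"
  using m3_scale[OF assms[THEN extend_G, THEN G_maps]] assms
  by (simp_all add: ternary_bracket_eq maps_scale extend_scale restrict_scale)

section \<open>The graded space of cochains and multilinearity of the structure maps\<close>

sublocale C: graded_vector_space "cochain_scale scale" "cochain_grading scale"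
proof -
  interpret C: vector_space "cochain_scale scale"
    by unfold_locales
       (simp_all add: cochain_scale_def fun_eq_iff scale_right_distrib scale_left_distrib)
  show "graded_vector_space (cochain_scale scale) (cochain_grading scale)"
  proof
    fix d show "C.subspace (cochain_grading scale d)"
      unfolding C.subspace_def cochain_grading_eq_maps cochain_scale_def
      by (auto intro: maps_zero maps_add maps_scale)
  next
    fix I and P :: "int \<Rightarrow> 'a list \<Rightarrow> 'a" and i
    assume *: "finite I" "\<And>i. i \<in> I \<Longrightarrow> P i \<in> cochain_grading scale i" "(\<Sum>i\<in>I. P i) = 0" "i \<in> I"
    have zero: "P j us = 0" if "j \<in> I" "int (length us) \<noteq> j" for j us
      using *(2)[OF that(1)] that(2) by (simp add: cochain_grading_eq_maps maps_len)
    have "P i us = 0" for us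
    proof (cases "int (length us) = i")
      case True
      have "P i us = (\<Sum>j\<in>I. P j us)"
        by (rule sum_single[symmetric]) (use * zero True in auto)
      also have "\<dots> = 0" using fun_cong[OF *(3), of us] by (simp add: sum_apply)
      finally show ?thesis .
    qed (use zero * in blast)
    then show "P i = 0" by (simp add: fun_eq_iff)
  qed
qed

lemma component_grading:
  assumes "P \<in> cochain_grading scale d"
  shows "cochain_component n P = (if int n = d then P else 0)"
  using maps_len[of P scale "d - 1"] assms
  by (auto simp: cochain_component_def fun_eq_iff cochain_grading_eq_maps)

lemma component_add: "cochain_component n (P + Q) = cochain_component n P + cochain_component n Q"
  and component_scale:
    "cochain_component n (cochain_scale scale c P) = (\<lambda>us. scale c (cochain_component n P us))"
  by (auto simp: cochain_component_def cochain_scale_def fun_eq_iff)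

lemma component_total:
  assumes "P \<in> C.total" shows "cochain_component n P \<in> maps scale (int n - 1)"
  using assms unfolding C.total_def
proof (induction rule: C.span_induct)
  show "C.subspace {P. cochain_component n P \<in> maps scale (int n - 1)}"
    unfolding C.subspace_def
    by (auto simp: component_add component_scale maps_add maps_scale)
       (simp add: maps_def multi_def cochain_component_def)
next
  fix P assume "P \<in> (\<Union>d. cochain_grading scale d)"
  then show "cochain_component n P \<in> maps scale (int n - 1)"
    by (auto simp: component_grading maps_zero cochain_grading_eq_maps)
qed

lemma grading_total: "P \<in> cochain_grading scale d \<Longrightarrow> P \<in> C.total"
  unfolding C.total_def by (rule C.span_base) auto

lemma cochain_structure_other: "k \<noteq> 2 \<Longrightarrow> k \<noteq> 3 \<Longrightarrow> cochain_structure k Ps = 0"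
  by (simp add: cochain_structure_def fun_eq_iff)

lemma multilinear_structure:
  "multilinear_on (cochain_scale scale) C.total (cochain_scale scale) k (cochain_structure k)"
proof -
  consider "k = 2" | "k = 3" | "k \<noteq> 2" "k \<noteq> 3" by blast
  then show ?thesis
  proof cases
    case 1
    note c = component_total
    have "cochain_structure 2 ([P, Q][i := y + z]) =
          cochain_structure 2 ([P, Q][i := y]) + cochain_structure 2 ([P, Q][i := z])"
        "cochain_structure 2 ([P, Q][i := cochain_scale scale t y]) =
          cochain_scale scale t (cochain_structure 2 ([P, Q][i := y]))"
      if "P \<in> C.total" "Q \<in> C.total" "y \<in> C.total" "z \<in> C.total" "i = 0 \<or> i = 1" for P Q y z i t
      using that(5)
      by (auto simp: cochain_structure_def fun_eq_iff case_prod_unfold component_add component_scale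
          binary_bracket_add[OF c[OF that(3)] c[OF that(4)] c[OF that(2)] c[OF that(2)]]
          binary_bracket_add[OF c[OF that(1)] c[OF that(1)] c[OF that(3)] c[OF that(4)]]
          binary_bracket_scale[OF c[OF that(3)] c[OF that(2)]]
          binary_bracket_scale[OF c[OF that(1)] c[OF that(3)]]
          sum.distrib scale_sum_right cochain_scale_def component_scale[unfolded cochain_scale_def])
    then show ?thesis
      unfolding 1 multilinear_on_def
      by (auto simp: length_2 less_2_cases_iff simp del: list_update.simps)
  next
    case 2
    note c = component_total
    have "cochain_structure 3 ([P, Q, R][i := y + z]) =
          cochain_structure 3 ([P, Q, R][i := y]) + cochain_structure 3 ([P, Q, R][i := z])"
        "cochain_structure 3 ([P, Q, R][i := cochain_scale scale t y]) =
          cochain_scale scale t (cochain_structure 3 ([P, Q, R][i := y]))"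
      if "P \<in> C.total" "Q \<in> C.total" "R \<in> C.total" "y \<in> C.total" "z \<in> C.total"
        "i = 0 \<or> i = 1 \<or> i = 2" for P Q R y z i t
      using that(6)
      by (auto simp: cochain_structure_def fun_eq_iff case_prod_unfold component_add component_scale
          ternary_bracket_add[OF c[OF that(4)] c[OF that(5)] c[OF that(2)] c[OF that(2)]
            c[OF that(3)] c[OF that(3)]]
          ternary_bracket_add[OF c[OF that(1)] c[OF that(1)] c[OF that(4)] c[OF that(5)]
            c[OF that(3)] c[OF that(3)]]
          ternary_bracket_add[OF c[OF that(1)] c[OF that(1)] c[OF that(2)] c[OF that(2)]
            c[OF that(4)] c[OF that(5)]]
          ternary_bracket_scale[OF c[OF that(4)] c[OF that(2)] c[OF that(3)]]
          ternary_bracket_scale[OF c[OF that(1)] c[OF that(4)] c[OF that(3)]]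
          ternary_bracket_scale[OF c[OF that(1)] c[OF that(2)] c[OF that(4)]]
          sum.distrib scale_sum_right cochain_scale_def component_scale[unfolded cochain_scale_def])
    moreover have "length Ps = 3 \<longleftrightarrow> (\<exists>P Q R. Ps = [P, Q, R])" for Ps :: "('a list \<Rightarrow> 'a) list"
      by (auto simp: length_Suc_conv eval_nat_numeral)
    moreover have "i < 3 \<longleftrightarrow> i = 0 \<or> i = 1 \<or> i = 2" for i :: nat by auto
    ultimately show ?thesis
      unfolding 2 multilinear_on_def by (auto simp del: list_update.simps)
  next
    case 3
    then show ?thesis
      by (simp add: multilinear_on_def cochain_structure_other)
  qed
qed

section \<open>The structure maps on homogeneous cochains\<close>

lemma extend_G': "P \<in> cochain_grading scale d \<Longrightarrow> extend P \<in> G (d - 1) 1"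
  by (simp add: cochain_grading_eq_maps extend_G)

lemma m2_zero: "y \<in> G d w \<Longrightarrow> m2 k 0 y = 0" "x \<in> G d w \<Longrightarrow> m2 k x 0 = 0"
  by (simp_all add: m2_def br_0_right[OF \<Theta>_G] br_0_left br_0_right[OF br[OF \<Theta>_G]])

lemma m3_zero:
  "y \<in> G d w \<Longrightarrow> z \<in> G e v \<Longrightarrow> m3 k 0 y z = 0"
  "x \<in> G d w \<Longrightarrow> z \<in> G e v \<Longrightarrow> m3 k x 0 z = 0"
  "x \<in> G d w \<Longrightarrow> y \<in> G e v \<Longrightarrow> m3 k x y 0 = 0"
  by (simp_all add: m3_def br_0_right[OF H_G] br_0_left br_0_right[OF br[OF H_G]]
      br_0_right[OF br[OF br[OF H_G]]])

lemma restrict_0 [simp]: "restrict_M 0 = 0"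
  by (simp add: restrict_M_def fun_eq_iff)

text \<open>At most one pair of arities contributes for homogeneous arguments. If a degree is
  negative or the length does not fit, there is none, and the derived bracket vanishes as
  well.\<close>

lemma structure_2:
  assumes P: "P \<in> cochain_grading scale d" and Q: "Q \<in> cochain_grading scale e"
  shows "cochain_structure 2 [P, Q] = restrict_M (m2 d (extend P) (extend Q))"
proof
  fix us :: "'a list"
  let ?S = "{(p, q). p + q = length us}"
  let ?f = "\<lambda>p q. binary_bracket p q (cochain_component p P) (cochain_component q Q) us"
  have fin: "finite ?S"
    by (rule finite_subset[of _ "{..length us} \<times> {..length us}"]) auto
  have comp: "cochain_component n P \<in> maps scale (int n - 1)"
    "cochain_component n Q \<in> maps scale (int n - 1)" for n
    using component_total P Q by (blast intro: grading_total)+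
  have f: "?f p q = restrict_M (m2 (int p) (extend (cochain_component p P))
      (extend (cochain_component q Q))) us" for p q
    by (simp add: binary_bracket_eq comp)
  have zero: "?f p q = 0" if "int p \<noteq> d \<or> int q \<noteq> e" for p q
    using that extend_G[OF comp(1)[of p]] extend_G[OF comp(2)[of q]]
    unfolding f by (auto simp: component_grading[OF P] component_grading[OF Q] m2_zero)
  have "cochain_structure 2 [P, Q] us = (\<Sum>(p, q)\<in>?S. ?f p q)"
    by (simp add: cochain_structure_def)
  also have "\<dots> = restrict_M (m2 d (extend P) (extend Q)) us"
  proof (cases "d < 0 \<or> e < 0 \<or> d + e \<noteq> int (length us)")
    case True
    have "m2 d (extend P) (extend Q) (map (Pair 0) us) = 0"
    proof (cases "d + e = int (length us)")
      case True
      with \<open>d < 0 \<or> e < 0 \<or> d + e \<noteq> int (length us)\<close> have "P = 0 \<or> Q = 0"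
        using P Q by (auto simp: cochain_grading_def)
      then show ?thesis using extend_G'[OF P] extend_G'[OF Q] by (auto simp: m2_zero)
    next
      case False
      then show ?thesis
        using maps_len[OF G_maps[OF m2_closed[OF extend_G'[OF P] extend_G'[OF Q], of d]]] by simp
    qed
    moreover have "(\<Sum>(p, q)\<in>?S. ?f p q) = 0"
      by (rule sum.neutral) (use True zero in fastforce)
    ultimately show ?thesis by (simp add: restrict_M_def)
  next
    case False
    then have "(\<Sum>(p, q)\<in>?S. ?f p q) = ?f (nat d) (nat e)"
      by (intro trans[OF sum_single[OF fin, of "(nat d, nat e)"]]) (auto intro!: zero)
    then show ?thesis using False
      unfolding f by (simp add: component_grading[OF P] component_grading[OF Q])
  qed
  finally show "cochain_structure 2 [P, Q] us = restrict_M (m2 d (extend P) (extend Q)) us" .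
qed

lemma structure_3:
  assumes P: "P \<in> cochain_grading scale d" and Q: "Q \<in> cochain_grading scale e"
    and R: "R \<in> cochain_grading scale k"
  shows "cochain_structure 3 [P, Q, R] = restrict_M (m3 e (extend P) (extend Q) (extend R))"
proof
  fix us :: "'a list"
  let ?S = "{(p, q, r). p + q + r = length us + 1}"
  let ?f = "\<lambda>p q r. ternary_bracket p q r (cochain_component p P) (cochain_component q Q)
    (cochain_component r R) us"
  have fin: "finite ?S"
    by (rule finite_subset[of _ "{..length us + 1} \<times> {..length us + 1} \<times> {..length us + 1}"]) auto
  have comp: "cochain_component n P \<in> maps scale (int n - 1)"
    "cochain_component n Q \<in> maps scale (int n - 1)" "cochain_component n R \<in> maps scale (int n - 1)" for n
    using component_total P Q R by (blast intro: grading_total)+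
  have f: "?f p q r = restrict_M (m3 (int q) (extend (cochain_component p P))
      (extend (cochain_component q Q)) (extend (cochain_component r R))) us" for p q r
    by (simp add: ternary_bracket_eq comp)
  have zero: "?f p q r = 0" if "int p \<noteq> d \<or> int q \<noteq> e \<or> int r \<noteq> k" for p q r
  proof -
    have "cochain_component p P = 0 \<or> cochain_component q Q = 0 \<or> cochain_component r R = 0"
      using that by (auto simp: component_grading[OF P] component_grading[OF Q] component_grading[OF R])
    then show ?thesis
      using extend_G[OF comp(1)[of p]] extend_G[OF comp(2)[of q]] extend_G[OF comp(3)[of r]]
      unfolding f by (auto simp: m3_zero)
  qed
  have "cochain_structure 3 [P, Q, R] us = (\<Sum>(p, q, r)\<in>?S. ?f p q r)"
    by (simp add: cochain_structure_def)
  also have "\<dots> = restrict_M (m3 e (extend P) (extend Q) (extend R)) us"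
  proof (cases "d < 0 \<or> e < 0 \<or> k < 0 \<or> d + e + k \<noteq> int (length us) + 1")
    case True
    have "m3 e (extend P) (extend Q) (extend R) (map (Pair 0) us) = 0"
    proof (cases "d + e + k = int (length us) + 1")
      case True
      with \<open>d < 0 \<or> e < 0 \<or> k < 0 \<or> d + e + k \<noteq> int (length us) + 1\<close> have "P = 0 \<or> Q = 0 \<or> R = 0"
        using P Q R by (auto simp: cochain_grading_def)
      then show ?thesis
        using extend_G'[OF P] extend_G'[OF Q] extend_G'[OF R] by (auto simp: m3_zero)
    next
      case False
      then show ?thesis
        using maps_len[OF G_maps[OF m3_closed[OF extend_G'[OF P] extend_G'[OF Q] extend_G'[OF R], of e]]]
        by simp
    qed
    moreover have "(\<Sum>(p, q, r)\<in>?S. ?f p q r) = 0"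
      by (rule sum.neutral) (use True zero in fastforce)
    ultimately show ?thesis by (simp add: restrict_M_def)
  next
    case False
    then have "(\<Sum>(p, q, r)\<in>?S. ?f p q r) = ?f (nat d) (nat e) (nat k)"
      by (intro trans[OF sum_single[OF fin, of "(nat d, nat e, nat k)"]]) (auto intro!: zero)
    then show ?thesis using False
      unfolding f by (simp add: component_grading[OF P] component_grading[OF Q] component_grading[OF R])
  qed
  finally show "cochain_structure 3 [P, Q, R] us =
      restrict_M (m3 e (extend P) (extend Q) (extend R)) us" .
qed

lemma extend_structure_2:
  assumes "P \<in> cochain_grading scale d" "Q \<in> cochain_grading scale e"
  shows "extend (cochain_structure 2 [P, Q]) = m2 d (extend P) (extend Q)"
  unfolding structure_2[OF assms]
  by (rule extend_restrict[OF m2_closed[OF assms[THEN extend_G']]])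

lemma extend_structure_3:
  assumes "P \<in> cochain_grading scale d" "Q \<in> cochain_grading scale e" "R \<in> cochain_grading scale k"
  shows "extend (cochain_structure 3 [P, Q, R]) = m3 e (extend P) (extend Q) (extend R)"
  unfolding structure_3[OF assms]
  using m3_closed[OF assms[THEN extend_G'], of e] by (intro extend_restrict) simp

lemma structure_2_grading:
  assumes "P \<in> cochain_grading scale d" "Q \<in> cochain_grading scale e"
  shows "cochain_structure 2 [P, Q] \<in> cochain_grading scale (d + e)"
  unfolding structure_2[OF assms] cochain_grading_eq_maps
  by (rule restrict_maps[OF m2_closed[OF assms[THEN extend_G']]])

lemma structure_3_grading:
  assumes "P \<in> cochain_grading scale d" "Q \<in> cochain_grading scale e" "R \<in> cochain_grading scale k"
  shows "cochain_structure 3 [P, Q, R] \<in> cochain_grading scale (d + e + k - 1)"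
  unfolding structure_3[OF assms] cochain_grading_eq_maps
  using restrict_maps[OF m3_closed[OF assms[THEN extend_G'], of e]] by (simp add: algebra_simps)

lemma cochain_scale_alt: "cochain_scale scale (of_int (alt e 1)) P = alt e P"
  by (simp add: alt_def cochain_scale_def fun_eq_iff)

text \<open>The orders \<open>zs\<close> of two or three arguments are enumerated; swaps of
  neighbours bring each back to the original order, and the accumulated sign is compared with
  \<open>inv_exp\<close>.\<close>

lemma structure_skew:
  assumes "length Ps = k" "C.homogeneous ds Ps" "distinct zs" "set zs = {..<k}"
  shows "cochain_structure k (map ((!) Ps) zs) = alt (inv_exp ((!) ds) zs) (cochain_structure k Ps)"
proof -
  consider "k = 2" | "k = 3" | "k \<noteq> 2" "k \<noteq> 3" by blast
  then show ?thesis
  proof cases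
    case 1
    with assms(1) obtain P Q where Ps: "Ps = [P, Q]" by (auto simp: length_2)
    with assms(2) obtain d e where ds: "ds = [d, e]"
      and P: "P \<in> cochain_grading scale d" and Q: "Q \<in> cochain_grading scale e"
      by (auto simp: C.homogeneous_def list_all2_Cons2)
    have "extend (cochain_structure 2 [Q, P]) = extend (alt (1 + e * d) (cochain_structure 2 [P, Q]))"
      unfolding extend_alt extend_structure_2[OF P Q] extend_structure_2[OF Q P]
      using m2_skew[OF P[THEN extend_G'] Q[THEN extend_G']] by (simp add: mult.commute)
    then have "cochain_structure 2 [Q, P] = alt (1 + e * d) (cochain_structure 2 [P, Q])"
      by (simp only: extend_eq_iff)
    moreover have "zs = [0, 1] \<or> zs = [1, 0]"
      using permutations_2[of zs] assms(3,4) 1 by blast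
    ultimately show ?thesis
      unfolding 1 Ps ds by (elim disjE) (simp_all add: alt_def[of 0])
  next
    case 2
    with assms(1) obtain P Q R where Ps: "Ps = [P, Q, R]"
      by (auto simp: length_Suc_conv eval_nat_numeral)
    with assms(2) obtain d e k where ds: "ds = [d, e, k]"
      and P: "P \<in> cochain_grading scale d" and Q: "Q \<in> cochain_grading scale e"
      and R: "R \<in> cochain_grading scale k"
      by (auto simp: C.homogeneous_def list_all2_Cons2)
    note x = P[THEN extend_G'] and y = Q[THEN extend_G'] and z = R[THEN extend_G']
    have "zs = [0, 1, 2] \<or> zs = [1, 0, 2] \<or> zs = [0, 2, 1] \<or> zs = [1, 2, 0] \<or> zs = [2, 0, 1] \<or>
        zs = [2, 1, 0]"
      using permutations_3[of zs] assms(3,4) 2 by blast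
    then have "extend (cochain_structure 3 (map ((!) [P, Q, R]) zs)) =
        extend (alt (inv_exp ((!) [d, e, k]) zs) (cochain_structure 3 [P, Q, R]))"
      unfolding extend_alt
      by (elim disjE;
          simp add: extend_structure_3[OF P Q R] extend_structure_3[OF P R Q]
          extend_structure_3[OF Q P R] extend_structure_3[OF Q R P] extend_structure_3[OF R P Q]
          extend_structure_3[OF R Q P] m3_skew_left[OF x z y] m3_skew_left[OF x y z]
          m3_skew_left[OF y z x] m3_skew_right[OF x y z] m3_skew_right[OF y x z];
          auto simp: alt_def)
    then show ?thesis unfolding 2 Ps ds by (simp only: extend_eq_iff)
  next
    case 3
    then show ?thesis by (simp add: cochain_structure_other)
  qed
qed

text \<open>Multilinearity, with the scalar 0 in the first slot.\<close>

lemma structure_zero: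
  assumes "set Ps \<subseteq> C.total" "length Ps + 1 = k"
  shows "cochain_structure k (0 # Ps) = 0"
proof -
  have z: "0 \<in> C.total" by (rule grading_total[of _ 0]) (simp add: cochain_grading_eq_maps maps_zero)
  have s: "cochain_scale scale 0 P = 0" for P by (simp add: cochain_scale_def fun_eq_iff)
  show ?thesis
    using multilinear_structure[of k, unfolded multilinear_on_def, rule_format, of "0 # Ps" 0 0 0 0]
      assms z s by simp
qed

section \<open>The higher Jacobi identities\<close>

lemma structure_jacobi_3:
  assumes "length Ps = 3" "C.homogeneous ds Ps"
  shows "(\<Sum>zs\<leftarrow>unshuffle_lists 2 3. alt (inv_exp ((!) ds) zs)
    (cochain_structure 2 [cochain_structure 2 [Ps ! (zs ! 0), Ps ! (zs ! 1)], Ps ! (zs ! 2)])) = 0"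
    (is "?S = 0")
proof -
  have g: "Ps ! i \<in> cochain_grading scale (ds ! i)" if "i < 3" for i
    using assms that by (simp add: C.homogeneous_def list_all2_conv_all_nth)
  \<comment> \<open>The locale wants a family indexed by all naturals. Padding with 0 is harmless,
    since 0 has every degree, whatever \<open>ds ! i\<close> is beyond the end of the list.\<close>
  interpret E: derived_brackets_elements G brk \<Theta> H "\<lambda>i. if i < 3 then extend (Ps ! i) else 0" "(!) ds"
    by unfold_locales (simp add: extend_G' g zero)
  have "extend (cochain_structure 2 [cochain_structure 2 [Ps ! i, Ps ! j], Ps ! k]) =
      m2 (ds ! i + ds ! j) (m2 (ds ! i) (extend (Ps ! i)) (extend (Ps ! j))) (extend (Ps ! k))"
    if "i < 3" "j < 3" "k < 3" for i j k
    using extend_structure_2[OF structure_2_grading[OF g g] g] extend_structure_2[OF g g] that by simp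
  then have "extend ?S = 0"
    using E.jacobi_3 unfolding extend_sum_list extend_alt by (simp add: unshuffle_lists_2_3)
  then show ?thesis using extend_eq_iff[of ?S 0] by simp
qed

lemma structure_jacobi_4:
  assumes "length Ps = 4" "C.homogeneous ds Ps"
  shows "(\<Sum>zs\<leftarrow>unshuffle_lists 2 4. alt (inv_exp ((!) ds) zs)
      (cochain_structure 3 [cochain_structure 2 [Ps ! (zs ! 0), Ps ! (zs ! 1)],
        Ps ! (zs ! 2), Ps ! (zs ! 3)])) -
    (\<Sum>zs\<leftarrow>unshuffle_lists 3 4. alt (inv_exp ((!) ds) zs)
      (cochain_structure 2 [cochain_structure 3 [Ps ! (zs ! 0), Ps ! (zs ! 1), Ps ! (zs ! 2)],
        Ps ! (zs ! 3)])) = 0" (is "?S = 0")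
proof -
  have g: "Ps ! i \<in> cochain_grading scale (ds ! i)" if "i < 4" for i
    using assms that by (simp add: C.homogeneous_def list_all2_conv_all_nth)
  interpret E: derived_brackets_elements G brk \<Theta> H "\<lambda>i. if i < 4 then extend (Ps ! i) else 0" "(!) ds"
    by unfold_locales (simp add: extend_G' g zero)
  have "extend (cochain_structure 3 [cochain_structure 2 [Ps ! i, Ps ! j], Ps ! k, Ps ! l]) =
      m3 (ds ! k) (m2 (ds ! i) (extend (Ps ! i)) (extend (Ps ! j))) (extend (Ps ! k)) (extend (Ps ! l))"
    "extend (cochain_structure 2 [cochain_structure 3 [Ps ! i, Ps ! j, Ps ! k], Ps ! l]) =
      m2 (ds ! i + ds ! j + ds ! k - 1)
        (m3 (ds ! j) (extend (Ps ! i)) (extend (Ps ! j)) (extend (Ps ! k))) (extend (Ps ! l))"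
    if "i < 4" "j < 4" "k < 4" "l < 4" for i j k l
    using extend_structure_3[OF structure_2_grading[OF g g] g g] extend_structure_2[OF g g]
      extend_structure_2[OF structure_3_grading[OF g g g] g] extend_structure_3[OF g g g] that
    by simp_all
  then have "extend ?S = 0"
    using E.jacobi_4 unfolding extend_diff extend_sum_list extend_alt
    by (simp add: unshuffle_lists_2_4 unshuffle_lists_3_4)
  then show ?thesis using extend_eq_iff[of ?S 0] by simp
qed

lemma structure_jacobi_5:
  assumes "length Ps = 5" "C.homogeneous ds Ps"
  shows "(\<Sum>zs\<leftarrow>unshuffle_lists 3 5. alt (inv_exp ((!) ds) zs)
    (cochain_structure 3 [cochain_structure 3 [Ps ! (zs ! 0), Ps ! (zs ! 1), Ps ! (zs ! 2)],
      Ps ! (zs ! 3), Ps ! (zs ! 4)])) = 0" (is "?S = 0")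
proof -
  have g: "Ps ! i \<in> cochain_grading scale (ds ! i)" if "i < 5" for i
    using assms that by (simp add: C.homogeneous_def list_all2_conv_all_nth)
  interpret E: derived_brackets_elements G brk \<Theta> H "\<lambda>i. if i < 5 then extend (Ps ! i) else 0" "(!) ds"
    by unfold_locales (simp add: extend_G' g zero)
  have "extend (cochain_structure 3 [cochain_structure 3 [Ps ! i, Ps ! j, Ps ! k], Ps ! l, Ps ! m]) =
      m3 (ds ! l) (m3 (ds ! j) (extend (Ps ! i)) (extend (Ps ! j)) (extend (Ps ! k)))
        (extend (Ps ! l)) (extend (Ps ! m))"
    if "i < 5" "j < 5" "k < 5" "l < 5" "m < 5" for i j k l m
    using extend_structure_3[OF structure_3_grading[OF g g g] g g] extend_structure_3[OF g g g] that
    by simp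
  then have "extend ?S = 0"
    using E.jacobi_5 unfolding extend_sum_list extend_alt by (simp add: unshuffle_lists_3_5)
  then show ?thesis using extend_eq_iff[of ?S 0] by simp
qed

text \<open>Terms with a trivial structure map drop out: an outer one is zero by definition, and an
  inner one feeds 0 into the outer map. The remaining inner sums are rewritten over the enumerated
  unshuffles.\<close>

lemma higher_jacobi_structure:
  assumes n: "n \<ge> 1" "length Ps = n" and hom: "C.homogeneous ds Ps"
  shows "(\<Sum>(i, j) \<in> {(i, j). 1 \<le> i \<and> 1 \<le> j \<and> i + j = n + 1}. \<Sum>\<sigma> \<in> unshuffles i n.
    cochain_scale scale (of_int (sign \<sigma> * koszul_sign ds \<sigma> * (- 1) ^ (i * (j - 1))))
      (cochain_structure j (cochain_structure i (take i (permute_list \<sigma> Ps)) #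
        drop i (permute_list \<sigma> Ps)))) = 0"
    (is "(\<Sum>(i, j)\<in>?I. ?F i j) = 0")
proof -
  have ds: "length ds = n" using hom n(2) by (simp add: C.homogeneous_def list_all2_lengthD)
  have tot: "set Ps \<subseteq> C.total"
    using hom grading_total by (fastforce simp: C.homogeneous_def list_all2_conv_all_nth in_set_conv_nth)
  have F: "?F i j = alt (int (i * (j - 1))) (\<Sum>zs\<leftarrow>unshuffle_lists i n. alt (inv_exp ((!) ds) zs)
      (cochain_structure j (cochain_structure i (take i (map ((!) Ps) zs)) # drop i (map ((!) Ps) zs))))"
    if "i \<le> n" "distinct (unshuffle_lists i n)" for i j
  proof -
    have "of_int (alt e 1 * (- 1) ^ m) = (of_int (alt (int m + e) 1) :: 'k)" for e m
      by (simp add: alt_def)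
    then show ?thesis
      using sum_unshuffles[OF n(2) ds that, of "\<lambda>s xs. cochain_scale scale
        (of_int (s * (- 1) ^ (i * (j - 1)))) (cochain_structure j (cochain_structure i (take i xs) # drop i xs))"]
      by (simp only: cochain_scale_alt alt_sum_list alt_alt)
  qed
  \<comment> \<open>The exponents \<open>i * (j - 1)\<close> for (i, j) = (2, 2), (2, 3), (3, 3) and
    (3, 2).\<close>
  have alts: "alt 2 x = x" "alt 4 x = x" "alt 6 x = x" "alt 3 x = - x" for x :: "'a list \<Rightarrow> 'a"
    by (simp_all add: alt_def)
  have zero: "?F i j = 0" if "(i, j) \<in> ?I" "i \<noteq> 2 \<and> i \<noteq> 3 \<or> j \<noteq> 2 \<and> j \<noteq> 3" for i j
  proof (rule sum.neutral, rule ballI)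
    fix \<sigma> assume "\<sigma> \<in> unshuffles i n"
    then have \<sigma>: "\<sigma> permutes {..<length Ps}" using n(2) by (simp add: unshuffles_def)
    let ?Qs = "drop i (permute_list \<sigma> Ps)"
    have "set ?Qs \<subseteq> C.total"
      using tot set_drop_subset[of i "permute_list \<sigma> Ps"] \<sigma> by auto
    moreover have "length ?Qs + 1 = j" using that n(2) by auto
    ultimately have "cochain_structure j (cochain_structure i (take i (permute_list \<sigma> Ps)) # ?Qs) = 0"
      using structure_zero[of ?Qs j] that(2) by (auto simp: cochain_structure_other)
    then show "cochain_scale scale (of_int (sign \<sigma> * koszul_sign ds \<sigma> * (- 1) ^ (i * (j - 1))))
        (cochain_structure j (cochain_structure i (take i (permute_list \<sigma> Ps)) # ?Qs)) = 0"
      by (simp add: cochain_scale_def fun_eq_iff)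
  qed
  have "finite ?I"
    by (rule finite_subset[of _ "{..n} \<times> {..n}"]) auto
  then have "(\<Sum>(i, j)\<in>?I. ?F i j) = (\<Sum>(i, j)\<in>{(i, j) \<in> ?I. i \<in> {2, 3} \<and> j \<in> {2, 3}}. ?F i j)"
    by (rule sum.mono_neutral_right) (use zero in force)+
  also have "\<dots> = 0"
  proof -
    consider "n = 3" | "n = 4" | "n = 5" | "n \<noteq> 3" "n \<noteq> 4" "n \<noteq> 5" by blast
    then show ?thesis
    proof cases
      case 1
      then have I: "{(i, j) \<in> ?I. i \<in> {2, 3} \<and> j \<in> {2, 3}} = {(2, 2)}" by auto
      have "?F 2 2 = 0"
        using F[of 2 2] structure_jacobi_3[of Ps ds] n(2) hom 1
        by (simp add: unshuffle_lists_2_3 alts)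
      then show ?thesis unfolding I by simp
    next
      case 2
      then have I: "{(i, j) \<in> ?I. i \<in> {2, 3} \<and> j \<in> {2, 3}} = {(2, 3), (3, 2)}" by auto
      have "?F 2 3 + ?F 3 2 = 0"
        using F[of 2 3] F[of 3 2] structure_jacobi_4[of Ps ds] n(2) hom 2
        by (simp add: unshuffle_lists_2_4 unshuffle_lists_3_4 alts)
      then show ?thesis unfolding I by simp
    next
      case 3
      then have I: "{(i, j) \<in> ?I. i \<in> {2, 3} \<and> j \<in> {2, 3}} = {(3, 3)}" by auto
      have "?F 3 3 = 0"
        using F[of 3 3] structure_jacobi_5[of Ps ds] n(2) hom 3
        by (simp add: unshuffle_lists_3_5 alts)
      then show ?thesis unfolding I by simp
    next
      case 4
      then have I: "{(i, j) \<in> ?I. i \<in> {2, 3} \<and> j \<in> {2, 3}} = {}" by auto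
      show ?thesis unfolding I by simp
    qed
  qed
  finally show ?thesis .
qed

lemma L_infinity: "L_infinity_algebra (cochain_scale scale) (cochain_grading scale) cochain_structure"
proof
  fix k show "multilinear_on (cochain_scale scale) C.total (cochain_scale scale) k (cochain_structure k)"
    by (rule multilinear_structure)
next
  fix k and xs :: "('a list \<Rightarrow> 'a) list" and ds
  assume *: "length xs = k" "C.homogeneous ds xs"
  consider "k = 2" | "k = 3" | "k \<noteq> 2" "k \<noteq> 3" by blast
  then show "cochain_structure k xs \<in> cochain_grading scale (sum_list ds + 2 - int k)"
  proof cases
    case 1
    then show ?thesis using * structure_2_grading
      by (auto simp: length_2 C.homogeneous_def list_all2_Cons2)
  next
    case 2
    then obtain P Q R d e f where "xs = [P, Q, R]" "ds = [d, e, f]" "P \<in> cochain_grading scale d"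
      "Q \<in> cochain_grading scale e" "R \<in> cochain_grading scale f"
      using * by (auto simp: length_Suc_conv eval_nat_numeral C.homogeneous_def list_all2_Cons2)
    then show ?thesis using structure_3_grading[of P d Q e R f] 2 by (simp add: algebra_simps)
  next
    case 3
    then show ?thesis by (simp add: cochain_structure_other cochain_grading_eq_maps maps_zero)
  qed
next
  fix k and xs :: "('a list \<Rightarrow> 'a) list" and ds \<sigma>
  assume *: "length xs = k" "C.homogeneous ds xs" "\<sigma> permutes {..<k}"
  have ds: "length ds = k" using * by (simp add: C.homogeneous_def list_all2_lengthD)
  have "permute_list \<sigma> xs = map ((!) xs) (map \<sigma> [0..<k])"
    using *(1) by (simp add: permute_list_def o_def)
  then show "cochain_structure k (permute_list \<sigma> xs) =
      cochain_scale scale (of_int (sign \<sigma> * koszul_sign ds \<sigma>)) (cochain_structure k xs)"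
    using structure_skew[OF *(1,2) permutes_map_upt[OF *(3)]]
    by (simp only: sign_koszul_sign[OF *(3) ds] cochain_scale_alt)
next
  fix n and xs :: "('a list \<Rightarrow> 'a) list" and ds
  assume "1 \<le> n" "length xs = n" "C.homogeneous ds xs"
  then show "(\<Sum>(i, j) \<in> {(i, j). 1 \<le> i \<and> 1 \<le> j \<and> i + j = n + 1}. \<Sum>\<sigma> \<in> unshuffles i n.
    cochain_scale scale (of_int (sign \<sigma> * koszul_sign ds \<sigma> * (- 1) ^ (i * (j - 1))))
      (cochain_structure j (cochain_structure i (take i (permute_list \<sigma> xs)) #
        drop i (permute_list \<sigma> xs)))) = 0"
    by (rule higher_jacobi_structure)
qed

section \<open>Maurer-Cartan elements\<close>

lemma cochain_of_map_grading:
  "cochain_of_map R \<in> cochain_grading scale 1 \<longleftrightarrow> Vector_Spaces.linear scale scale R"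
proof
  assume "cochain_of_map R \<in> cochain_grading scale 1"
  then have "multi scale (cochain_of_map R)" by (simp add: cochain_grading_eq_maps maps_def)
  from multi_add[OF this, of "[]" _ _ "[]"] multi_scale[OF this, of "[]" _ _ "[]"]
  show "Vector_Spaces.linear scale scale R"
    by unfold_locales (simp_all add: cochain_of_map_def)
next
  assume "Vector_Spaces.linear scale scale R"
  then interpret R: Vector_Spaces.linear scale scale R .
  show "cochain_of_map R \<in> cochain_grading scale 1"
    by (auto simp: cochain_grading_eq_maps maps_def multi_def cochain_of_map_def R.add R.scale)
qed

text \<open>For three equal arguments of arity 1 the six \<open>nested\<close> sums coincide, signs
  included, and the binary bracket is likewise twice an expression. The factors 1/6 and 1/2 cancel
  these multiplicities.\<close>

lemma maurer_cartan_cochain_of_map: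
  assumes "Vector_Spaces.linear scale scale R"
  shows "maurer_cartan (cochain_scale scale) (cochain_grading scale) cochain_structure (cochain_of_map R)
    \<longleftrightarrow> (\<forall>a b. R a * R b = R (a * R b + R a * b - R a * R b))"
proof -
  interpret R: Vector_Spaces.linear scale scale R by (rule assms)
  let ?\<alpha> = "cochain_of_map R"
  have \<alpha>: "?\<alpha> \<in> cochain_grading scale 1" using assms by (simp add: cochain_of_map_grading)
  then have \<alpha>': "?\<alpha> \<in> maps scale (int 1 - 1)" by (simp add: cochain_grading_eq_maps)
  have 2: "cochain_structure 2 [?\<alpha>, ?\<alpha>] = binary_bracket 1 1 ?\<alpha> ?\<alpha>"
    using structure_2[OF \<alpha> \<alpha>] binary_bracket_eq[OF \<alpha>' \<alpha>'] by simp
  have 3: "cochain_structure 3 [?\<alpha>, ?\<alpha>, ?\<alpha>] = ternary_bracket 1 1 1 ?\<alpha> ?\<alpha> ?\<alpha>"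
    using structure_3[OF \<alpha> \<alpha> \<alpha>] ternary_bracket_eq[OF \<alpha>' \<alpha>' \<alpha>'] by simp
  have half: "scale (1 / 2) (x + x) = x" for x
    using scale_left_distrib[of "1 / 2" "1 / 2" x] by (simp add: scale_right_distrib)
  have sixth: "scale (1 / 6) (x + x + x + x + x + x) = x" for x
  proof -
    have "x + x + x + x + x + x = scale 6 x"
      using scale_left_distrib[of 1 1 x] scale_left_distrib[of 2 1 x] scale_left_distrib[of 3 1 x]
        scale_left_distrib[of 4 1 x] scale_left_distrib[of 5 1 x] by simp
    then show ?thesis by simp
  qed
  define E where "E us = cochain_structure 1 [?\<alpha>] us + scale (1 / 2) (cochain_structure 2 [?\<alpha>, ?\<alpha>] us) -
      scale (1 / 6) (cochain_structure 3 [?\<alpha>, ?\<alpha>, ?\<alpha>] us)" for us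
  \<comment> \<open>Both brackets of elements of degree 1 have degree 2, so the equation has content
    only on two arguments.\<close>
  have E0: "E us = 0" if "length us \<noteq> 2" for us
    using that by (simp add: E_def 2 3 cochain_structure_other binary_bracket_def ternary_bracket_def)
  have E2: "E [a, b] = (R (a * R b) + R (R a * b) - R a * R b) - R (R a * R b)" for a b
  proof -
    let ?x = "R (a * R b) + R (R a * b) - R a * R b"
    have "binary_bracket 1 1 ?\<alpha> ?\<alpha> [a, b] = ?x + ?x"
      by (simp add: binary_bracket_def gerstenhaber_def gerstenhaber_comp_def insert_at_def
          semidirect_def extend_def cochain_of_map_def numeral_2_eq_2 alt_def R.add)
    moreover have "ternary_bracket 1 1 1 ?\<alpha> ?\<alpha> ?\<alpha> [a, b] = (let y = R (R a * R b) in y + y + y + y + y + y)"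
      by (simp add: ternary_bracket_def nested_def neg_mult_def cochain_of_map_def alt_def R.neg Let_def)
    ultimately show ?thesis
      unfolding E_def 2 3 Let_def by (simp only: half sixth) (simp add: cochain_structure_other)
  qed
  have "maurer_cartan (cochain_scale scale) (cochain_grading scale) cochain_structure ?\<alpha> \<longleftrightarrow> (\<forall>us. E us = 0)"
    using \<alpha> by (simp add: maurer_cartan_def fun_eq_iff E_def cochain_scale_def)
  also have "\<dots> \<longleftrightarrow> (\<forall>a b. E [a, b] = 0)"
    using E0 length_2 by metis
  also have "\<dots> \<longleftrightarrow> (\<forall>a b. R a * R b = R (a * R b + R a * b - R a * R b))"
    unfolding E2 by (auto simp: R.add R.diff algebra_simps)
  finally show ?thesis .
qed

lemma bij_maurer_cartan:
  "bij_betw cochain_of_map {R. reynolds_operator scale R}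
    {\<alpha>. maurer_cartan (cochain_scale scale) (cochain_grading scale) cochain_structure \<alpha>}"
proof (rule bij_betw_byWitness[of _ "\<lambda>\<alpha> a. \<alpha> [a]"])
  have inv: "cochain_of_map (\<lambda>a. \<alpha> [a]) = \<alpha>" if "\<alpha> \<in> cochain_grading scale 1" for \<alpha> :: "'a list \<Rightarrow> 'a"
  proof
    fix us show "cochain_of_map (\<lambda>a. \<alpha> [a]) us = \<alpha> us"
      using that maps_len[of \<alpha> scale 0 us]
      by (auto simp: cochain_of_map_def cochain_grading_eq_maps length_Suc_conv)
  qed
  have mc: "\<alpha> \<in> cochain_grading scale 1"
    if "maurer_cartan (cochain_scale scale) (cochain_grading scale) cochain_structure \<alpha>" for \<alpha> :: "'a list \<Rightarrow> 'a"
    using that by (simp add: maurer_cartan_def)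
  show "\<forall>R\<in>{R. reynolds_operator scale R}. (\<lambda>a. cochain_of_map R [a]) = R"
    by (simp add: cochain_of_map_def)
  show "\<forall>\<alpha>\<in>{\<alpha>. maurer_cartan (cochain_scale scale) (cochain_grading scale) cochain_structure \<alpha>}.
      cochain_of_map (\<lambda>a. \<alpha> [a]) = \<alpha>"
    using inv mc by blast
  show "cochain_of_map ` {R. reynolds_operator scale R} \<subseteq>
      {\<alpha>. maurer_cartan (cochain_scale scale) (cochain_grading scale) cochain_structure \<alpha>}"
    by (auto simp: reynolds_operator_def maurer_cartan_cochain_of_map)
  show "(\<lambda>\<alpha> a. \<alpha> [a]) ` {\<alpha>. maurer_cartan (cochain_scale scale) (cochain_grading scale) cochain_structure \<alpha>}
      \<subseteq> {R. reynolds_operator scale R}"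
  proof (rule image_subsetI)
    fix \<alpha> :: "'a list \<Rightarrow> 'a"
    assume "\<alpha> \<in> {\<alpha>. maurer_cartan (cochain_scale scale) (cochain_grading scale) cochain_structure \<alpha>}"
    then have *: "maurer_cartan (cochain_scale scale) (cochain_grading scale) cochain_structure
        (cochain_of_map (\<lambda>a. \<alpha> [a]))"
      using inv mc by simp
    moreover from mc[OF *] have "Vector_Spaces.linear scale scale (\<lambda>a. \<alpha> [a])"
      by (simp only: cochain_of_map_grading)
    ultimately show "(\<lambda>a. \<alpha> [a]) \<in> {R. reynolds_operator scale R}"
      by (simp add: reynolds_operator_def maurer_cartan_cochain_of_map)
  qed
qed

end

theorem theorem4p9:
  fixes scale :: "'k::field_char_0 \<Rightarrow> 'a::ring \<Rightarrow> 'a"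
  assumes "assoc_algebra scale"
  shows "L_infinity_algebra (cochain_scale scale) (cochain_grading scale) cochain_structure \<and>
    bij_betw cochain_of_map
      {R. reynolds_operator scale R}
      {\<alpha>. maurer_cartan (cochain_scale scale) (cochain_grading scale) cochain_structure \<alpha>}"
proof -
  interpret assoc_algebra scale by (rule assms)
  show ?thesis using L_infinity bij_maurer_cartan by simp
qed

end
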